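(* Suppose the testing algorithm has black-box access to both $U$ and $U^\dagger$ (each application of either counting as one query). Then for every $n\ge1$ and $\epsilon>0$ there is a quantum algorithm that $\epsilon$-tests the Clifford group $\mathcal{C}_n$ using $O(1/\epsilon^2)$ queries, with implied constant independent of $n$ and $\epsilon$.
   Context: $n\ge1$, $N=2^n$, $\mathbb{U}_N$ the $N\times N$ unitaries. Pauli matrices $\sigma_0=I,\sigma_1=X,\sigma_2=Y,\sigma_3=Z$; for $\vec{x}\in\mathbb{Z}_4^n$, $\sigma_{\vec{x}}=\sigma_{x_1}\otimes\cdots\otimes\sigma_{x_n}$. $\mathcal{P}_n=\{i^k\sigma_{\vec{x}}: k\in\{0,1,2,3\},\vec{x}\in\mathbb{Z}_4^n\}$; $\mathcal{C}_n=\{U\in\mathbb{U}_N: UhU^\dagger\in\mathcal{P}_n\ \forall h\in\mathcal{P}_n\}$. $\|A\|=\sqrt{\mathrm{tr}(A^\dagger A)}$; $D(A,B)=\min_{\theta\in[0,2\pi)}\frac{1}{\sqrt{2N}}\|e^{i\theta}A-B\|$; $D(A,\mathcal{S})=\inf_{B\in\mathcal{S}}D(A,B)$. For $\mathcal{S}\subseteq\mathbb{U}_N$, $U$ has property $\mathcal{S}$ if $U=e^{i\theta}V$ for some $V\in\mathcal{S}$, real $\theta$; $U$ is $\epsilon$-far from $\mathcal{S}$ if $D(U,V)\ge\epsilon$ for all $V\in\mathcal{S}$. Testing model: the unknown $U$ is a black box; the algorithm may prepare arbitrary states on the system plus an ancilla, apply the black boxes (tensored with identity on the ancilla), interleaved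 with arbitrary fixed quantum operations, and measure. It $\epsilon$-tests $\mathcal{S}$ if for every $U\in\mathbb{U}_N$ it accepts with probability $\ge2/3$ when $U$ has property $\mathcal{S}$ and with probability $\le1/3$ when $U$ is $\epsilon$-far from $\mathcal{S}$. *)

theory Defs
  imports Complex_Main "Jordan_Normal_Form.Matrix"
begin

definition adj :: "complex mat \<Rightarrow> complex mat" where
  "adj A = mat (dim_col A) (dim_row A) (\<lambda>(i,j). cnj (A $$ (j,i)))"

definition unitary_mat :: "nat \<Rightarrow> complex mat \<Rightarrow> bool" where
  "unitary_mat d U \<longleftrightarrow> U \<in> carrier_mat d d \<and> adj U * U = 1\<^sub>m d \<and> U * adj U = 1\<^sub>m d"

definition unitaries :: "nat \<Rightarrow> complex mat set" where
  "unitaries d = {U. unitary_mat d U}"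

text \<open>Kronecker (tensor) product; index (a,b) of the product corresponds to a * dim B + b.\<close>
definition kron :: "complex mat \<Rightarrow> complex mat \<Rightarrow> complex mat" where
  "kron A B = mat (dim_row A * dim_row B) (dim_col A * dim_col B)
     (\<lambda>(i,j). A $$ (i div dim_row B, j div dim_col B) * B $$ (i mod dim_row B, j mod dim_col B))"

definition pauli1 :: "nat \<Rightarrow> complex mat" where
  "pauli1 k = (if k = 1 then mat_of_rows_list 2 [[0, 1], [1, 0]]
       else if k = 2 then mat_of_rows_list 2 [[0, -\<i>], [\<i>, 0]]
       else if k = 3 then mat_of_rows_list 2 [[1, 0], [0, -1]]
       else 1\<^sub>m 2)"

fun pauli_string :: "nat list \<Rightarrow> complex mat" where
  "pauli_string [] = 1\<^sub>m 1"
| "pauli_string (x # xs) = kron (pauli1 x) (pauli_string xs)"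

definition pauli_group :: "nat \<Rightarrow> complex mat set" where
  "pauli_group n = {(\<i> ^ k) \<cdot>\<^sub>m pauli_string xs | k xs.
       k < 4 \<and> length xs = n \<and> (\<forall>x \<in> set xs. x < 4)}"

definition clifford_group :: "nat \<Rightarrow> complex mat set" where
  "clifford_group n = {U \<in> unitaries (2 ^ n).
       \<forall>h \<in> pauli_group n. U * h * adj U \<in> pauli_group n}"

definition hs_norm :: "complex mat \<Rightarrow> real" where
  "hs_norm A = sqrt (\<Sum>i<dim_row A. \<Sum>j<dim_col A. (cmod (A $$ (i,j)))\<^sup>2)"

definition dist_phase :: "complex mat \<Rightarrow> complex mat \<Rightarrow> real" where
  "dist_phase A B = (INF \<theta>\<in>{0..<2*pi}.
       hs_norm (exp (\<i> * of_real \<theta>) \<cdot>\<^sub>m A - B) / sqrt (2 * real (dim_row A)))"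

definition has_property :: "complex mat set \<Rightarrow> complex mat \<Rightarrow> bool" where
  "has_property S U \<longleftrightarrow> (\<exists>V \<in> S. \<exists>\<theta>::real. U = exp (\<i> * of_real \<theta>) \<cdot>\<^sub>m V)"

definition eps_far :: "real \<Rightarrow> complex mat set \<Rightarrow> complex mat \<Rightarrow> bool" where
  "eps_far \<epsilon> S U \<longleftrightarrow> (\<forall>V \<in> S. dist_phase U V \<ge> \<epsilon>)"

text \<open>A query algorithm on an N-dimensional system with an M-dimensional ancilla:
  initial state psi, fixed unitaries V_0,...,V_q on the joint space, a list of q query types
  (False = apply U (x) I, True = apply U^dagger (x) I), and a final projective measurement
  given by an orthogonal projector P (outcome "accept").  The applied circuit is
  V_q Q_q ... V_1 Q_1 V_0 psi.  Intermediate measurements and classical post-processing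
  are covered by deferred measurement; general operations by Stinespring dilation.\<close>
record query_alg =
  anc_dim :: nat
  init_state :: "complex vec"
  ops :: "complex mat list"
  qtypes :: "bool list"
  accept_proj :: "complex mat"

definition num_queries :: "query_alg \<Rightarrow> nat" where
  "num_queries A = length (qtypes A)"

definition vnorm2 :: "complex vec \<Rightarrow> real" where
  "vnorm2 v = (\<Sum>i<dim_vec v. (cmod (v $ i))\<^sup>2)"

definition valid_alg :: "nat \<Rightarrow> query_alg \<Rightarrow> bool" where
  "valid_alg N A \<longleftrightarrow>
     (let D = N * anc_dim A in
       anc_dim A > 0 \<and>
       init_state A \<in> carrier_vec D \<and> vnorm2 (init_state A) = 1 \<and>
       length (ops A) = length (qtypes A) + 1 \<and>
       (\<forall>V \<in> set (ops A). unitary_mat D V) \<and>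
       accept_proj A \<in> carrier_mat D D \<and>
       adj (accept_proj A) = accept_proj A \<and>
       accept_proj A * accept_proj A = accept_proj A)"

definition query_op :: "complex mat \<Rightarrow> nat \<Rightarrow> bool \<Rightarrow> complex mat" where
  "query_op U M b = kron (if b then adj U else U) (1\<^sub>m M)"

definition final_state :: "query_alg \<Rightarrow> complex mat \<Rightarrow> complex vec" where
  "final_state A U =
     foldl (\<lambda>v (b, V). V *\<^sub>v (query_op U (anc_dim A) b *\<^sub>v v))
       (hd (ops A) *\<^sub>v init_state A) (zip (qtypes A) (tl (ops A)))"

definition accept_prob :: "query_alg \<Rightarrow> complex mat \<Rightarrow> real" where
  "accept_prob A U = vnorm2 (accept_proj A *\<^sub>v final_state A U)"

definition eps_tests :: "nat \<Rightarrow> real \<Rightarrow> complex mat set \<Rightarrow> query_alg \<Rightarrow> bool" where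
  "eps_tests N \<epsilon> S A \<longleftrightarrow> valid_alg N A \<and>
     (\<forall>U \<in> unitaries N.
        (has_property S U \<longrightarrow> accept_prob A U \<ge> 2/3) \<and>
        (eps_far \<epsilon> S U \<longrightarrow> accept_prob A U \<le> 1/3))"

end

theory Submission
  imports Defs "Jordan_Normal_Form.Determinant" "HOL-Analysis.L2_Norm"
begin

text \<open>
  One round of the test draws a uniformly random element \<open>g\<close> of the Pauli group, prepares two copies
  of the Choi state of \<open>U g U\<^sup>\<dagger>\<close> (four queries), measures both in the basis of Choi states of Pauli
  strings and accepts if the outcomes agree. A Clifford \<open>U\<close> always passes. Conversely, suppose that
  the rejection probability \<open>\<delta>\<close> is small. Then for most \<open>g\<close> the operator \<open>U g U\<^sup>\<dagger>\<close> is close to a Pauli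
  operator in normalised Hilbert-Schmidt norm. Every group element is a product of two such \<open>g\<close>, so
  this holds for all \<open>g\<close>, and since distinct Pauli operators are \<open>\<surd>2\<close> apart the nearest one \<open>T g\<close> is
  unique and \<open>T\<close> is a homomorphism. The average \<open>V\<close> of \<open>T g U g\<^sup>\<dagger>\<close> satisfies \<open>T g V = V g\<close>, so \<open>V\<^sup>\<dagger> V\<close>
  commutes with all Pauli operators and is scalar: a multiple of \<open>V\<close> is Clifford, and its squared
  distance from \<open>U\<close> is at most \<open>4 \<delta>\<close>. Hence \<open>O(1/\<epsilon>\<^sup>2)\<close> rounds suffice.
\<close>

text \<open>Measuring the Choi state of \<open>U * g * adj U\<close> yields each Pauli string with
  probability equal to its squared normalised coefficient. Comparing two copies tests whether this
  distribution is concentrated, without knowing on which string. Preparing the state takes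
  \<open>adj U\<close> before \<open>g\<close> and \<open>U\<close> after it, which is where the
  inverse oracle enters. The bound must be free of n and quadratic in 1/\<epsilon>. The first holds
  because the separation of Pauli operators in normalised norm and the majority threshold are
  absolute constants. The second needs a squared distance linear in the rejection probability,
  whereas generation by two factors only gives a constant radius. Uniqueness is therefore used once
  more: for each good \<open>g\<close> it identifies \<open>T g\<close> with the Pauli operator
  found from the collision statistic of \<open>g\<close> itself, while each bad \<open>g\<close>
  already contributes more than 1/40 to the rejection sum. Phases stay in the group so that
  \<open>T\<close> is multiplicative exactly, not just up to a phase. Since Clifford inputs are
  accepted with certainty, rounds are combined by requiring all of them to accept.\<close>

section \<open>Splitting a product index into its two digits\<close>

text \<open>Matches the index convention of \<open>kron\<close>: every sum over a tensor index below
  is written through \<open>div\<close> and \<open>mod\<close> and then separated by this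
  rule.\<close>

lemma sum_div_mod:
  fixes f :: "nat \<Rightarrow> nat \<Rightarrow> 'a::comm_monoid_add"
  shows "(\<Sum>i<a*b. f (i div b) (i mod b)) = (\<Sum>i<a. \<Sum>j<b. f i j)"
proof (cases "b = 0")
  case False
  have "(\<Sum>i<a*b. f (i div b) (i mod b)) = (\<Sum>(i,j)\<in>{..<a} \<times> {..<b}. f i j)"
  proof (rule sum.reindex_bij_witness[where i = "\<lambda>(i,j). i*b+j" and j = "\<lambda>k. (k div b, k mod b)"])
    fix p assume p: "p \<in> {..<a} \<times> {..<b}"
    then obtain i j where [simp]: "p = (i,j)" and ij: "i < a" "j < b" by auto
    have "i * b + j < Suc i * b" using ij by simp
    also have "\<dots> \<le> a * b" using ij by (intro mult_le_mono1) simp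
    finally show "(case p of (i, j) \<Rightarrow> i * b + j) \<in> {..<a * b}" by simp
  qed (use False in \<open>auto simp: less_mult_imp_div_less\<close>)
  then show ?thesis by (simp add: sum.cartesian_product)
qed simp

lemma div_mod_less:
  fixes i a b :: nat assumes "i < a * b" shows "i div b < a" "i mod b < b"
proof -
  have "b > 0" using assms by (cases b) auto
  then show "i div b < a" "i mod b < b" using assms by (auto simp: less_mult_imp_div_less)
qed

lemma div_mod_eq_iff: "i div b = j div b \<and> i mod b = j mod b \<longleftrightarrow> i = (j::nat)"
  by (metis div_mult_mod_eq)

section \<open>Adjoints and the Hilbert-Schmidt inner product\<close>

lemma adj_dim [simp]: "dim_row (adj A) = dim_col A" "dim_col (adj A) = dim_row A"
  by (simp_all add: adj_def)

lemma adj_carrier [simp, intro]: "A \<in> carrier_mat m n \<Longrightarrow> adj A \<in> carrier_mat n m"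
  by (auto simp: adj_def)

lemma index_adj [simp]: "i < dim_col A \<Longrightarrow> j < dim_row A \<Longrightarrow> adj A $$ (i,j) = cnj (A $$ (j,i))"
  by (simp add: adj_def)

lemma adj_adj [simp]: "adj (adj A) = A"
  by (rule eq_matI) auto

lemma adj_one [simp]: "adj (1\<^sub>m n) = 1\<^sub>m n"
  by (rule eq_matI) auto

lemma adj_mult: "A \<in> carrier_mat m n \<Longrightarrow> B \<in> carrier_mat n k \<Longrightarrow> adj (A * B) = adj B * adj A"
  by (rule eq_matI) (auto simp: scalar_prod_def mult.commute)

lemma adj_smult: "adj (c \<cdot>\<^sub>m A) = cnj c \<cdot>\<^sub>m adj A"
  by (rule eq_matI) auto

lemma mult_square_carrier [simp, intro]:
  "A \<in> carrier_mat n n \<Longrightarrow> B \<in> carrier_mat n n \<Longrightarrow> A * B \<in> carrier_mat n n"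
  by simp

lemma unitary_matD:
  assumes "unitary_mat d U"
  shows "U \<in> carrier_mat d d" "adj U * U = 1\<^sub>m d" "U * adj U = 1\<^sub>m d"
  using assms by (auto simp: unitary_mat_def)

lemma unitary_mat_adj: "unitary_mat d U \<Longrightarrow> unitary_mat d (adj U)"
  by (simp add: unitary_mat_def)

lemma unitary_mat_one [simp]: "unitary_mat d (1\<^sub>m d)"
  by (simp add: unitary_mat_def)

lemma unitary_cancel_left:
  assumes "unitary_mat d U" "A \<in> carrier_mat d k"
  shows "adj U * (U * A) = A" "U * (adj U * A) = A"
  using unitary_matD[OF assms(1)] assms(2)
  by (simp_all flip: assoc_mult_mat[of _ d d _ d _ k])

lemma unitary_mat_mult:
  assumes U: "unitary_mat d U" and V: "unitary_mat d V" shows "unitary_mat d (U * V)"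
  using unitary_matD[OF U] unitary_matD[OF V] unitary_cancel_left[OF U, where k = d]
    unitary_cancel_left[OF V, where k = d]
  by (simp add: unitary_mat_def adj_mult[of _ d d _ d] assoc_mult_mat[of _ d d _ d _ d])

definition mtrace :: "complex mat \<Rightarrow> complex" where
  "mtrace A = (\<Sum>i<dim_row A. A $$ (i,i))"

lemma mtrace_comm:
  assumes "A \<in> carrier_mat m n" "B \<in> carrier_mat n m"
  shows "mtrace (A * B) = mtrace (B * A)"
  using assms unfolding mtrace_def
  by (simp add: scalar_prod_def atLeast0LessThan)
     (subst sum.swap, auto simp: mult.commute intro!: sum.cong)

definition hs_inner :: "complex mat \<Rightarrow> complex mat \<Rightarrow> complex" where
  "hs_inner A B = (\<Sum>i<dim_row A. \<Sum>j<dim_col A. cnj (A $$ (i,j)) * B $$ (i,j))"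

lemma hs_inner_trace:
  assumes "A \<in> carrier_mat m n" "B \<in> carrier_mat m n"
  shows "hs_inner A B = mtrace (adj A * B)"
  using assms unfolding hs_inner_def mtrace_def
  by (subst sum.swap) (auto simp: scalar_prod_def atLeast0LessThan intro!: sum.cong)

lemma hs_inner_mult_left:
  assumes "U \<in> carrier_mat n n" "A \<in> carrier_mat n n" "B \<in> carrier_mat n n"
  shows "hs_inner (U * A) B = hs_inner A (adj U * B)"
  using assms by (simp add: hs_inner_trace[of _ n n] adj_mult[of _ n n _ n] assoc_mult_mat[of _ n n _ n _ n])

lemma hs_inner_mult_right:
  assumes "U \<in> carrier_mat n n" "A \<in> carrier_mat n n" "B \<in> carrier_mat n n"
  shows "hs_inner (A * U) B = hs_inner A (B * adj U)"
proof -
  have "mtrace (adj U * (adj A * B)) = mtrace (adj A * B * adj U)"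
    using assms by (intro mtrace_comm[of _ n n]) auto
  then show ?thesis using assms
    by (simp add: hs_inner_trace[of _ n n] adj_mult[of _ n n _ n] assoc_mult_mat[of _ n n _ n _ n])
qed

lemma hs_inner_smult_right:
  assumes "A \<in> carrier_mat m n" "B \<in> carrier_mat m n"
  shows "hs_inner A (c \<cdot>\<^sub>m B) = c * hs_inner A B"
  using assms by (auto simp: hs_inner_def sum_distrib_left mult_ac intro!: sum.cong)

lemma hs_inner_smult_left:
  assumes "A \<in> carrier_mat m n" "B \<in> carrier_mat m n"
  shows "hs_inner (c \<cdot>\<^sub>m A) B = cnj c * hs_inner A B"
  using assms by (auto simp: hs_inner_def sum_distrib_left mult_ac intro!: sum.cong)

lemma hs_inner_commute:
  assumes "A \<in> carrier_mat m n" "B \<in> carrier_mat m n"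
  shows "hs_inner B A = cnj (hs_inner A B)"
  using assms by (auto simp: hs_inner_def mult_ac intro!: sum.cong)

lemma hs_inner_self: "hs_inner A A = of_real ((hs_norm A)\<^sup>2)"
proof -
  have "(hs_norm A)\<^sup>2 = (\<Sum>i<dim_row A. \<Sum>j<dim_col A. (cmod (A $$ (i,j)))\<^sup>2)"
    unfolding hs_norm_def by (intro real_sqrt_pow2 sum_nonneg) auto
  then show ?thesis unfolding hs_inner_def
    by (simp only: of_real_sum complex_norm_square mult.commute[of "cnj _"])
qed

lemma hs_norm_nonneg: "hs_norm A \<ge> 0"
  unfolding hs_norm_def by (intro real_sqrt_ge_zero sum_nonneg) auto

text \<open>Identifies the norm with a Euclidean norm on entries, so that the triangle inequality
  can be imported from \<open>L2_set\<close>.\<close>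

lemma hs_norm_L2_set:
  "hs_norm A = L2_set (\<lambda>(i,j). cmod (A $$ (i,j))) ({..<dim_row A} \<times> {..<dim_col A})"
  unfolding hs_norm_def L2_set_def by (simp add: sum.cartesian_product case_prod_unfold)

lemma hs_norm_triangle:
  assumes "A \<in> carrier_mat m n" "B \<in> carrier_mat m n" "C \<in> carrier_mat m n"
  shows "hs_norm (A - C) \<le> hs_norm (A - B) + hs_norm (B - C)"
proof -
  let ?I = "{..<m} \<times> {..<n}"
  have "hs_norm (A - C) = L2_set (\<lambda>(i,j). cmod (A $$ (i,j) - C $$ (i,j))) ?I"
    using assms by (auto simp: hs_norm_L2_set intro!: L2_set_cong)
  also have "\<dots> \<le> L2_set (\<lambda>p. cmod (A $$ p - B $$ p) + cmod (B $$ p - C $$ p)) ?I"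
    by (rule L2_set_mono) (auto intro: norm_triangle_sub order_trans[OF _ norm_triangle_ineq])
  also have "\<dots> \<le> L2_set (\<lambda>p. cmod (A $$ p - B $$ p)) ?I + L2_set (\<lambda>p. cmod (B $$ p - C $$ p)) ?I"
    by (rule L2_set_triangle_ineq)
  also have "\<dots> = hs_norm (A - B) + hs_norm (B - C)"
    using assms by (auto simp: hs_norm_L2_set intro!: arg_cong2[of _ _ _ _ "(+)"] L2_set_cong)
  finally show ?thesis .
qed

lemma hs_norm_commute:
  assumes "A \<in> carrier_mat m n" "B \<in> carrier_mat m n"
  shows "hs_norm (A - B) = hs_norm (B - A)"
  using assms by (auto simp: hs_norm_L2_set norm_minus_commute intro!: L2_set_cong)

lemma hs_norm_diff_square:
  assumes "A \<in> carrier_mat m n" "B \<in> carrier_mat m n"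
  shows "(hs_norm (A - B))\<^sup>2 = (hs_norm A)\<^sup>2 + (hs_norm B)\<^sup>2 - 2 * Re (hs_inner A B)"
proof -
  have "hs_inner (A - B) (A - B) = hs_inner A A + hs_inner B B - hs_inner A B - hs_inner B A"
    using assms by (simp add: hs_inner_def sum.distrib[symmetric] sum_subtractf[symmetric] algebra_simps)
  then have "Re (hs_inner (A - B) (A - B)) = Re (hs_inner A A) + Re (hs_inner B B) - Re (hs_inner A B) - Re (hs_inner B A)"
    by simp
  then show ?thesis by (simp add: hs_inner_self hs_inner_commute[OF assms])
qed

lemma hs_norm_mult_unitary_left:
  assumes "unitary_mat n U" "A \<in> carrier_mat n n"
  shows "hs_norm (U * A) = hs_norm A"
proof -
  note u = unitary_matD[OF assms(1)]
  have "hs_inner (U * A) (U * A) = hs_inner A (adj U * U * A)"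
    using u(1) assms(2) by (simp add: hs_inner_mult_left[of _ n] assoc_mult_mat[of _ n n _ n _ n])
  then have "(hs_norm (U * A))\<^sup>2 = (hs_norm A)\<^sup>2"
    using u assms(2) by (simp add: hs_inner_self flip: of_real_power)
  then show ?thesis by (simp add: hs_norm_nonneg power2_eq_iff_nonneg)
qed

lemma hs_norm_mult_unitary_right:
  assumes "unitary_mat n U" "A \<in> carrier_mat n n"
  shows "hs_norm (A * U) = hs_norm A"
proof -
  note u = unitary_matD[OF assms(1)]
  have "hs_inner (A * U) (A * U) = hs_inner A (A * (U * adj U))"
    using u(1) assms(2) by (simp add: hs_inner_mult_right[of _ n] assoc_mult_mat[of _ n n _ n _ n])
  then have "(hs_norm (A * U))\<^sup>2 = (hs_norm A)\<^sup>2"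
    using u assms(2) by (simp add: hs_inner_self flip: of_real_power)
  then show ?thesis by (simp add: hs_norm_nonneg power2_eq_iff_nonneg)
qed

lemma hs_norm_unitary_square:
  assumes "unitary_mat n U" shows "(hs_norm U)\<^sup>2 = real n"
proof -
  note u = unitary_matD[OF assms]
  have "hs_inner U U = mtrace (1\<^sub>m n)"
    using u by (simp add: hs_inner_trace[of _ n n])
  then have "complex_of_real ((hs_norm U)\<^sup>2) = of_real (real n)"
    by (simp add: hs_inner_self mtrace_def)
  then show ?thesis by (simp only: of_real_eq_iff)
qed

text \<open>The phase is chosen as the argument of the inner product. Since \<open>hs_inner\<close>
  is conjugate-linear in its first slot, this rotates the inner product onto its modulus, and the
  squared norm becomes 2 N minus twice that modulus.\<close>

lemma dist_phase_le:
  assumes U: "unitary_mat N U" and V: "unitary_mat N V" and N: "N > 0"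
  shows "dist_phase U V \<le> sqrt (1 - cmod (hs_inner U V) / N)"
proof -
  let ?z = "hs_inner U V"
  \<comment> \<open>\<open>Arg\<close> takes values in (-pi, pi], while the infimum in
    \<open>dist_phase\<close> ranges over [0, 2 pi), hence the shift.\<close>
  define \<theta> where "\<theta> = (if Arg ?z < 0 then Arg ?z + 2 * pi else Arg ?z)"
  have th: "\<theta> \<in> {0..<2*pi}"
    using Arg_bounded[of ?z] by (auto simp: \<theta>_def)
  have e: "exp (\<i> * of_real \<theta>) = cis (Arg ?z)"
    by (auto simp: \<theta>_def cis_conv_exp[symmetric] simp flip: cis_mult)
  have "cnj (cis (Arg ?z)) * ?z = cmod ?z"
    using rcis_cmod_Arg[of ?z] unfolding rcis_def
    by (metis (no_types, lifting) cis_cnj cis_mult cis_zero left_minus mult.commute mult.left_commute mult_1_right)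
  then have "Re (hs_inner (exp (\<i> * of_real \<theta>) \<cdot>\<^sub>m U) V) = cmod ?z"
    unfolding e using unitary_matD(1)[OF U] unitary_matD(1)[OF V] by (simp add: hs_inner_smult_left[of _ N N])
  moreover have "(hs_norm (exp (\<i> * of_real \<theta>) \<cdot>\<^sub>m U))\<^sup>2 = (hs_norm U)\<^sup>2"
  proof -
    have "hs_norm (exp (\<i> * of_real \<theta>) \<cdot>\<^sub>m U) = hs_norm U"
      using unitary_matD(1)[OF U] by (simp add: hs_norm_def norm_mult)
    then show ?thesis by simp
  qed
  ultimately have sq: "(hs_norm (exp (\<i> * of_real \<theta>) \<cdot>\<^sub>m U - V))\<^sup>2 = 2 * N - 2 * cmod ?z"
    using unitary_matD(1)[OF U] unitary_matD(1)[OF V]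
    by (simp add: hs_norm_diff_square[of _ N N] hs_norm_unitary_square[OF U] hs_norm_unitary_square[OF V])
  have "hs_norm (exp (\<i> * of_real \<theta>) \<cdot>\<^sub>m U - V) / sqrt (2 * real N) = sqrt (1 - cmod ?z / N)"
  proof -
    have "hs_norm (exp (\<i> * of_real \<theta>) \<cdot>\<^sub>m U - V) = sqrt (2 * N - 2 * cmod ?z)"
      using real_sqrt_unique[OF sq hs_norm_nonneg] by simp
    moreover have "(2 * N - 2 * cmod ?z) / (2 * real N) = 1 - cmod ?z / N"
      using N by (simp add: field_simps)
    ultimately show ?thesis by (metis real_sqrt_divide)
  qed
  moreover have "dist_phase U V \<le> hs_norm (exp (\<i> * of_real \<theta>) \<cdot>\<^sub>m U - V) / sqrt (2 * real (dim_row U))"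
    unfolding dist_phase_def
    by (rule cINF_lower[OF _ th]) (auto intro!: bdd_belowI[of _ 0] divide_nonneg_nonneg hs_norm_nonneg)
  ultimately show ?thesis using unitary_matD(1)[OF U] by simp
qed

section \<open>Pauli strings\<close>

lemma kron_dim [simp]:
  "dim_row (kron A B) = dim_row A * dim_row B" "dim_col (kron A B) = dim_col A * dim_col B"
  by (simp_all add: kron_def)

lemma kron_carrier:
  "A \<in> carrier_mat a b \<Longrightarrow> B \<in> carrier_mat c d \<Longrightarrow> kron A B \<in> carrier_mat (a * c) (b * d)"
  by (auto simp: kron_def)

lemma index_kron:
  assumes "A \<in> carrier_mat a b" "B \<in> carrier_mat c d" "i < a * c" "j < b * d"
  shows "kron A B $$ (i,j) = A $$ (i div c, j div d) * B $$ (i mod c, j mod d)"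
  using assms by (auto simp: kron_def)

lemma kron_mult:
  assumes A: "A \<in> carrier_mat a1 a2" and C: "C \<in> carrier_mat a2 a3"
    and B: "B \<in> carrier_mat b1 b2" and D: "D \<in> carrier_mat b2 b3"
  shows "kron A B * kron C D = kron (A * C) (B * D)"
proof (rule eq_matI)
  fix i j assume "i < dim_row (kron (A * C) (B * D))" "j < dim_col (kron (A * C) (B * D))"
  then have ij: "i < a1 * b1" "j < a3 * b3" using assms by auto
  note dm = div_mod_less[OF ij(1)] div_mod_less[OF ij(2)]
  let ?f = "\<lambda>k l. A $$ (i div b1, k) * B $$ (i mod b1, l) * (C $$ (k, j div b3) * D $$ (l, j mod b3))"
  have "(kron A B * kron C D) $$ (i,j) = (\<Sum>k<a2*b2. kron A B $$ (i,k) * kron C D $$ (k,j))"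
    using assms ij by (simp add: scalar_prod_def atLeast0LessThan)
  also have "\<dots> = (\<Sum>k<a2*b2. ?f (k div b2) (k mod b2))"
    using ij by (simp add: index_kron[OF A B] index_kron[OF C D])
  also have "\<dots> = (\<Sum>k<a2. \<Sum>l<b2. ?f k l)" by (rule sum_div_mod)
  also have "\<dots> = (\<Sum>k<a2. A $$ (i div b1, k) * C $$ (k, j div b3)) * (\<Sum>l<b2. B $$ (i mod b1, l) * D $$ (l, j mod b3))"
    by (simp add: sum_product mult_ac)
  also have "\<dots> = kron (A * C) (B * D) $$ (i,j)"
    using assms ij dm by (simp add: index_kron[of _ a1 a3 _ b1 b3] scalar_prod_def atLeast0LessThan)
  finally show "(kron A B * kron C D) $$ (i,j) = kron (A * C) (B * D) $$ (i,j)" .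
qed (use assms in auto)

lemma adj_kron: "adj (kron A B) = kron (adj A) (adj B)"
proof (rule eq_matI)
  fix i j assume "i < dim_row (kron (adj A) (adj B))" "j < dim_col (kron (adj A) (adj B))"
  then have "i < dim_col A * dim_col B" "j < dim_row A * dim_row B" by auto
  with div_mod_less[OF this(1)] div_mod_less[OF this(2)]
  show "adj (kron A B) $$ (i,j) = kron (adj A) (adj B) $$ (i,j)" by (simp add: kron_def)
qed auto

lemma kron_one: "kron (1\<^sub>m a) (1\<^sub>m b) = 1\<^sub>m (a * b)"
proof (rule eq_matI)
  fix i j assume "i < dim_row (1\<^sub>m (a * b) :: complex mat)" "j < dim_col (1\<^sub>m (a * b) :: complex mat)"
  then have "i < a * b" "j < a * b" by auto
  with div_mod_less[OF this(1)] div_mod_less[OF this(2)] div_mod_eq_iff[of i b j]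
  show "kron (1\<^sub>m a) (1\<^sub>m b) $$ (i,j) = 1\<^sub>m (a * b) $$ (i,j)" by (auto simp: kron_def)
qed auto

lemma kron_smult: "kron (c \<cdot>\<^sub>m A) (d \<cdot>\<^sub>m B) = (c * d) \<cdot>\<^sub>m kron A B"
proof (rule eq_matI)
  fix i j assume "i < dim_row ((c * d) \<cdot>\<^sub>m kron A B)" "j < dim_col ((c * d) \<cdot>\<^sub>m kron A B)"
  then have "i < dim_row A * dim_row B" "j < dim_col A * dim_col B" by auto
  with div_mod_less[OF this(1)] div_mod_less[OF this(2)]
  show "kron (c \<cdot>\<^sub>m A) (d \<cdot>\<^sub>m B) $$ (i,j) = ((c * d) \<cdot>\<^sub>m kron A B) $$ (i,j)" by (simp add: kron_def)
qed auto

lemma hs_inner_kron: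
  assumes A: "A \<in> carrier_mat a b" and C: "C \<in> carrier_mat a b"
    and B: "B \<in> carrier_mat c d" and D: "D \<in> carrier_mat c d"
  shows "hs_inner (kron A B) (kron C D) = hs_inner A C * hs_inner B D"
proof -
  let ?f = "\<lambda>i k j l. cnj (A $$ (i,j) * B $$ (k,l)) * (C $$ (i,j) * D $$ (k,l))"
  have "hs_inner (kron A B) (kron C D) =
      (\<Sum>i<a*c. \<Sum>j<b*d. ?f (i div c) (i mod c) (j div d) (j mod d))"
    using assms by (simp add: hs_inner_def kron_def)
  also have "\<dots> = (\<Sum>i<a*c. \<Sum>j<b. \<Sum>l<d. ?f (i div c) (i mod c) j l)"
    by (intro sum.cong sum_div_mod refl)
  also have "\<dots> = (\<Sum>i<a. \<Sum>k<c. \<Sum>j<b. \<Sum>l<d. ?f i k j l)"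
    by (rule sum_div_mod)
  also have "\<dots> = (\<Sum>i<a. \<Sum>k<c. (\<Sum>j<b. cnj (A $$ (i,j)) * C $$ (i,j)) * (\<Sum>l<d. cnj (B $$ (k,l)) * D $$ (k,l)))"
    by (simp add: sum_product mult_ac)
  also have "\<dots> = hs_inner A C * hs_inner B D"
    using A B by (simp add: hs_inner_def sum_product)
  finally show ?thesis .
qed

section \<open>The single-qubit Pauli matrices\<close>

text \<open>A closed form preserved by product, scaling and adjoint, so that identities between
  Pauli matrices reduce to identities between four scalars.\<close>

definition mat2 :: "complex \<Rightarrow> complex \<Rightarrow> complex \<Rightarrow> complex \<Rightarrow> complex mat" where
  "mat2 a b c d = mat_of_rows_list 2 [[a, b], [c, d]]"

lemma mat2_carrier [simp]: "mat2 a b c d \<in> carrier_mat 2 2"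
  by (simp add: mat2_def mat_of_rows_list_def numeral_2_eq_2)

lemma mat2_dim [simp]: "dim_row (mat2 a b c d) = 2" "dim_col (mat2 a b c d) = 2"
  using mat2_carrier by blast+

lemma index_mat2 [simp]:
  "mat2 a b c d $$ (0,0) = a" "mat2 a b c d $$ (0,Suc 0) = b"
  "mat2 a b c d $$ (Suc 0,0) = c" "mat2 a b c d $$ (Suc 0,Suc 0) = d"
  by (simp_all add: mat2_def mat_of_rows_list_def)

lemma mat2_eqI:
  assumes "A \<in> carrier_mat 2 2" "B \<in> carrier_mat 2 2"
    "A $$ (0,0) = B $$ (0,0)" "A $$ (0,Suc 0) = B $$ (0,Suc 0)"
    "A $$ (Suc 0,0) = B $$ (Suc 0,0)" "A $$ (Suc 0,Suc 0) = B $$ (Suc 0,Suc 0)"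
  shows "A = B"
  using assms by (intro eq_matI) (auto simp: less_2_cases_iff)

lemma mat2_eq_iff: "mat2 a b c d = mat2 e f g h \<longleftrightarrow> a = e \<and> b = f \<and> c = g \<and> d = h"
proof
  assume "mat2 a b c d = mat2 e f g h"
  then have "mat2 a b c d $$ p = mat2 e f g h $$ p" for p by simp
  from this[of "(0,0)"] this[of "(0,Suc 0)"] this[of "(Suc 0,0)"] this[of "(Suc 0,Suc 0)"]
  show "a = e \<and> b = f \<and> c = g \<and> d = h" by simp
qed simp

lemma sum_less_2: "(\<Sum>i<2. f i) = f 0 + (f (Suc 0) :: complex)"
  by (simp add: numeral_2_eq_2)

lemma mat2_mult:
  "mat2 a b c d * mat2 e f g h = mat2 (a*e+b*g) (a*f+b*h) (c*e+d*g) (c*f+d*h)"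
  by (rule mat2_eqI) (simp_all add: scalar_prod_def atLeast0LessThan sum_less_2 mult_carrier_mat[of _ 2 2 _ 2])

lemma mat2_smult: "z \<cdot>\<^sub>m mat2 a b c d = mat2 (z*a) (z*b) (z*c) (z*d)"
  by (rule mat2_eqI) simp_all

lemma mat2_adj: "adj (mat2 a b c d) = mat2 (cnj a) (cnj c) (cnj b) (cnj d)"
  by (rule mat2_eqI) simp_all

lemma one_mat2: "1\<^sub>m 2 = mat2 1 0 0 1"
  by (rule mat2_eqI) simp_all

lemma pauli1_mat2:
  "pauli1 0 = mat2 1 0 0 1" "pauli1 (Suc 0) = mat2 0 1 1 0" "pauli1 1 = mat2 0 1 1 0"
  "pauli1 2 = mat2 0 (-\<i>) \<i> 0" "pauli1 3 = mat2 1 0 0 (-1)"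
  by (simp_all add: pauli1_def mat2_def one_mat2)

lemma less_4_cases: "(x::nat) < 4 \<Longrightarrow> x = 0 \<or> x = 1 \<or> x = 2 \<or> x = 3"
  by auto

lemma i_power_cube: "\<i> ^ 3 = - \<i>"
  by (simp add: numeral_3_eq_3)

lemma i_power_mod_4: "\<i> ^ (k mod 4) = \<i> ^ k"
proof -
  have "\<i> ^ k = (\<i> ^ 4) ^ (k div 4) * \<i> ^ (k mod 4)"
    by (metis mult_div_mod_eq power_add power_mult)
  then show ?thesis by simp
qed

lemma pauli1_carrier [simp]: "pauli1 x \<in> carrier_mat 2 2"
  unfolding pauli1_def by (auto simp: mat_of_rows_list_def)

lemma pauli1_dim [simp]: "dim_row (pauli1 x) = 2" "dim_col (pauli1 x) = 2"
  using pauli1_carrier by blast+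

lemma pauli1_mult:
  assumes "a < 4" "b < 4"
  shows "\<exists>k c. c < 4 \<and> pauli1 a * pauli1 b = \<i> ^ k \<cdot>\<^sub>m pauli1 c"
proof -
  have *: "pauli1 1 * pauli1 2 = \<i> ^ 1 \<cdot>\<^sub>m pauli1 3" "pauli1 2 * pauli1 1 = \<i> ^ 3 \<cdot>\<^sub>m pauli1 3"
    "pauli1 2 * pauli1 3 = \<i> ^ 1 \<cdot>\<^sub>m pauli1 1" "pauli1 3 * pauli1 2 = \<i> ^ 3 \<cdot>\<^sub>m pauli1 1"
    "pauli1 3 * pauli1 1 = \<i> ^ 1 \<cdot>\<^sub>m pauli1 2" "pauli1 1 * pauli1 3 = \<i> ^ 3 \<cdot>\<^sub>m pauli1 2"
    by (simp_all add: pauli1_mat2 mat2_mult mat2_smult mat2_eq_iff i_power_cube)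
  have **: "pauli1 x * pauli1 x = \<i> ^ 0 \<cdot>\<^sub>m pauli1 0" "pauli1 0 * pauli1 x = \<i> ^ 0 \<cdot>\<^sub>m pauli1 x"
    "pauli1 x * pauli1 0 = \<i> ^ 0 \<cdot>\<^sub>m pauli1 x" if "x < 4" for x
    using less_4_cases[OF that]
    by (elim disjE; simp add: pauli1_mat2 mat2_mult mat2_smult)+
  have lt: "(0::nat) < 4" "(1::nat) < 4" "(2::nat) < 4" "(3::nat) < 4" by auto
  consider "a = b" | "a = 0" | "b = 0" | "a = 1" "b = 2" | "a = 2" "b = 1"
    | "a = 2" "b = 3" | "a = 3" "b = 2" | "a = 3" "b = 1" | "a = 1" "b = 3"
    using less_4_cases[OF assms(1)] less_4_cases[OF assms(2)] by blast
  then show ?thesis using * **[OF assms(1)] **[OF assms(2)] lt assms by cases blast+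
qed

lemma pauli1_adj: "adj (pauli1 a) = pauli1 a"
proof (cases "a < 4")
  case True
  from less_4_cases[OF this] show ?thesis
    by (elim disjE; simp add: pauli1_mat2 mat2_adj)
qed (simp add: pauli1_def)

lemma pauli1_square: "pauli1 a * pauli1 a = 1\<^sub>m 2"
proof (cases "a < 4")
  case True
  from less_4_cases[OF this] show ?thesis
    by (elim disjE; simp add: pauli1_mat2 mat2_mult one_mat2)
qed (simp add: pauli1_def)

lemma pauli1_orthogonal:
  assumes "a < 4" "b < 4" shows "hs_inner (pauli1 a) (pauli1 b) = (if a = b then 2 else 0)"
  using less_4_cases[OF assms(1)] less_4_cases[OF assms(2)]
  by (elim disjE; simp add: hs_inner_def pauli1_mat2 sum_less_2)

lemma pauli1_complete:
  assumes "i < 2" "j < 2" "k < 2" "l < 2"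
  shows "(\<Sum>a<4. cnj (pauli1 a $$ (i,j)) * pauli1 a $$ (k,l)) = (if i = k \<and> j = l then 2 else 0)"
proof -
  have *: "{..<4} = {0,1,2,3::nat}" by auto
  have "i = 0 \<or> i = Suc 0" "j = 0 \<or> j = Suc 0" "k = 0 \<or> k = Suc 0" "l = 0 \<or> l = Suc 0"
    using assms by auto
  then show ?thesis unfolding * by (elim disjE; simp add: pauli1_mat2)
qed

section \<open>Pauli strings as an orthogonal operator basis\<close>

definition pauli_strings :: "nat \<Rightarrow> nat list set" where
  "pauli_strings n = {xs. set xs \<subseteq> {..<4} \<and> length xs = n}"

lemma finite_pauli_strings [simp]: "finite (pauli_strings n)"
  unfolding pauli_strings_def by (rule finite_lists_length_eq) simp

lemma pauli_strings_Suc: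
  "pauli_strings (Suc n) = (\<lambda>(x,xs). x # xs) ` ({..<4} \<times> pauli_strings n)"
  unfolding pauli_strings_def set_eq_iff image_iff by (auto simp: length_Suc_conv)

lemma sum_pauli_strings_Suc:
  "(\<Sum>xs\<in>pauli_strings (Suc n). f xs) = (\<Sum>x<4. \<Sum>xs\<in>pauli_strings n. f (x # xs))"
  unfolding pauli_strings_Suc sum.cartesian_product
  by (subst sum.reindex) (auto simp: inj_on_def case_prod_unfold)

lemma pauli_strings_length: "xs \<in> pauli_strings n \<Longrightarrow> length xs = n"
  by (simp add: pauli_strings_def)

lemma pauli_strings_nonempty: "replicate n 0 \<in> pauli_strings n"
  by (auto simp: pauli_strings_def)

lemma pauli_string_carrier: "pauli_string xs \<in> carrier_mat (2 ^ length xs) (2 ^ length xs)"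
  by (induction xs) (auto intro: kron_carrier[OF pauli1_carrier])

lemma pauli_string_carrier' [simp]:
  "xs \<in> pauli_strings n \<Longrightarrow> pauli_string xs \<in> carrier_mat (2 ^ n) (2 ^ n)"
  using pauli_string_carrier[of xs] by (simp add: pauli_strings_def)

lemma pauli_string_adj: "adj (pauli_string xs) = pauli_string xs"
  by (induction xs) (simp_all add: adj_kron pauli1_adj)

lemma pauli_string_square: "pauli_string xs * pauli_string xs = 1\<^sub>m (2 ^ length xs)"
  by (induction xs)
    (simp_all add: kron_mult[OF pauli1_carrier pauli1_carrier pauli_string_carrier pauli_string_carrier]
      pauli1_square kron_one)

lemma pauli_string_zero: "pauli_string (replicate n 0) = 1\<^sub>m (2 ^ n)"
  by (induction n) (simp_all add: pauli1_def kron_one)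

lemma pauli_string_mult:
  "xs \<in> pauli_strings n \<Longrightarrow> ys \<in> pauli_strings n \<Longrightarrow>
    \<exists>k. \<exists>zs\<in>pauli_strings n. pauli_string xs * pauli_string ys = \<i> ^ k \<cdot>\<^sub>m pauli_string zs"
proof (induction n arbitrary: xs ys)
  case 0
  then show ?case by (auto simp: pauli_strings_def intro!: exI[of _ 0] eq_matI)
next
  case (Suc n)
  then obtain x xs' y ys' where eq: "xs = x # xs'" "ys = y # ys'"
    and xy: "x < 4" "y < 4" and s: "xs' \<in> pauli_strings n" "ys' \<in> pauli_strings n"
    by (auto simp: pauli_strings_Suc)
  obtain k c where c: "c < 4" "pauli1 x * pauli1 y = \<i> ^ k \<cdot>\<^sub>m pauli1 c"
    using pauli1_mult[OF xy] by blast
  obtain l zs where z: "zs \<in> pauli_strings n"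
    "pauli_string xs' * pauli_string ys' = \<i> ^ l \<cdot>\<^sub>m pauli_string zs"
    using Suc.IH[OF s] by blast
  have "pauli_string xs * pauli_string ys = \<i> ^ (k + l) \<cdot>\<^sub>m pauli_string (c # zs)"
    using s by (simp add: eq kron_mult[OF pauli1_carrier pauli1_carrier, of _ "2^n" "2^n" _ "2^n"]
        c z kron_smult power_add)
  moreover have "c # zs \<in> pauli_strings (Suc n)" using c z by (auto simp: pauli_strings_def)
  ultimately show ?case by blast
qed

lemma pauli_string_orthogonal:
  "xs \<in> pauli_strings n \<Longrightarrow> ys \<in> pauli_strings n \<Longrightarrow>
    hs_inner (pauli_string xs) (pauli_string ys) = (if xs = ys then 2 ^ n else 0)"
proof (induction n arbitrary: xs ys)
  case 0
  then show ?case by (simp add: pauli_strings_def hs_inner_def)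
next
  case (Suc n)
  then obtain x xs' y ys' where eq: "xs = x # xs'" "ys = y # ys'"
    and xy: "x < 4" "y < 4" and s: "xs' \<in> pauli_strings n" "ys' \<in> pauli_strings n"
    by (auto simp: pauli_strings_Suc)
  show ?case using s
    by (simp add: eq hs_inner_kron[OF pauli1_carrier pauli1_carrier, of _ "2^n" "2^n"]
        pauli1_orthogonal[OF xy] Suc.IH)
qed

text \<open>Completeness of the basis, the dual of orthogonality. It is inherited from one qubit
  because the entries of a Kronecker product factor over the two digits of each index. Both Parseval
  and the commutant computation rest on it.\<close>

lemma pauli_string_complete:
  "i < 2 ^ n \<Longrightarrow> j < 2 ^ n \<Longrightarrow> k < 2 ^ n \<Longrightarrow> l < 2 ^ n \<Longrightarrow>
    (\<Sum>xs\<in>pauli_strings n. cnj (pauli_string xs $$ (i,j)) * pauli_string xs $$ (k,l))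
      = (if i = k \<and> j = l then 2 ^ n else 0)"
proof (induction n arbitrary: i j k l)
  case 0
  then show ?case by (simp add: pauli_strings_def cong: conj_cong)
next
  case (Suc n)
  let ?N = "2 ^ n :: nat"
  have b: "i < 2 * ?N" "j < 2 * ?N" "k < 2 * ?N" "l < 2 * ?N" using Suc.prems by auto
  note dm = div_mod_less[OF b(1)] div_mod_less[OF b(2)] div_mod_less[OF b(3)] div_mod_less[OF b(4)]
  have "(\<Sum>xs\<in>pauli_strings (Suc n). cnj (pauli_string xs $$ (i,j)) * pauli_string xs $$ (k,l))
     = (\<Sum>x<4. \<Sum>xs\<in>pauli_strings n.
        (cnj (pauli1 x $$ (i div ?N, j div ?N)) * pauli1 x $$ (k div ?N, l div ?N)) *
        (cnj (pauli_string xs $$ (i mod ?N, j mod ?N)) * pauli_string xs $$ (k mod ?N, l mod ?N)))"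
    using b by (simp add: sum_pauli_strings_Suc index_kron[OF pauli1_carrier pauli_string_carrier'] mult_ac)
  also have "\<dots> = (if i div ?N = k div ?N \<and> j div ?N = l div ?N then 2 else 0) *
      (if i mod ?N = k mod ?N \<and> j mod ?N = l mod ?N then 2 ^ n else 0)"
    using dm by (simp only: sum_product[symmetric] pauli1_complete Suc.IH)
  also have "\<dots> = (if i = k \<and> j = l then 2 ^ Suc n else 0)"
    using div_mod_eq_iff[of i ?N k] div_mod_eq_iff[of j ?N l] by auto
  finally show ?case .
qed

text \<open>Expanding the squared moduli gives a double sum over entry positions, in which
  completeness leaves only the diagonal. The factor \<open>2 ^ n\<close> is the squared norm of a
  Pauli string.\<close>

lemma pauli_string_parseval:
  assumes B: "B \<in> carrier_mat (2 ^ n) (2 ^ n)"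
  shows "(\<Sum>xs\<in>pauli_strings n. (cmod (hs_inner (pauli_string xs) B))\<^sup>2) = 2 ^ n * (hs_norm B)\<^sup>2"
proof -
  let ?N = "2 ^ n :: nat"
  let ?I = "{..<?N} \<times> {..<?N}"
  have ip: "hs_inner A B = (\<Sum>p\<in>?I. cnj (A $$ p) * B $$ p)" if "A \<in> carrier_mat ?N ?N" for A B
    using that by (simp add: hs_inner_def sum.cartesian_product case_prod_unfold)
  have "complex_of_real (\<Sum>xs\<in>pauli_strings n. (cmod (hs_inner (pauli_string xs) B))\<^sup>2)
      = (\<Sum>xs\<in>pauli_strings n. hs_inner (pauli_string xs) B * cnj (hs_inner (pauli_string xs) B))"
    by (simp only: of_real_sum complex_norm_square)
  also have "\<dots> = (\<Sum>xs\<in>pauli_strings n. \<Sum>p\<in>?I. \<Sum>q\<in>?I.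
      cnj (pauli_string xs $$ p) * pauli_string xs $$ q * (B $$ p * cnj (B $$ q)))"
    by (intro sum.cong refl) (simp add: ip sum_product mult_ac)
  also have "\<dots> = (\<Sum>p\<in>?I. \<Sum>q\<in>?I. (\<Sum>xs\<in>pauli_strings n.
      cnj (pauli_string xs $$ p) * pauli_string xs $$ q) * (B $$ p * cnj (B $$ q)))"
    by (subst sum.swap, intro sum.cong refl, subst sum.swap) (simp add: sum_distrib_right)
  also have "\<dots> = (\<Sum>p\<in>?I. \<Sum>q\<in>?I. if p = q then 2 ^ n * (B $$ p * cnj (B $$ q)) else 0)"
  proof (intro sum.cong refl)
    fix p q assume "p \<in> ?I" "q \<in> ?I"
    then obtain i j k l where "p = (i,j)" "q = (k,l)" "i < ?N" "j < ?N" "k < ?N" "l < ?N" by auto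
    then show "(\<Sum>xs\<in>pauli_strings n. cnj (pauli_string xs $$ p) * pauli_string xs $$ q) * (B $$ p * cnj (B $$ q))
        = (if p = q then 2 ^ n * (B $$ p * cnj (B $$ q)) else 0)"
      by (simp add: pauli_string_complete)
  qed
  also have "\<dots> = 2 ^ n * hs_inner B B"
    by (simp add: ip[OF B] sum_distrib_left mult_ac)
  also have "\<dots> = complex_of_real (2 ^ n * (hs_norm B)\<^sup>2)" by (simp add: hs_inner_self)
  finally show ?thesis by (simp only: of_real_eq_iff)
qed

text \<open>Twirling: commutation gives \<open>A = S * A * S\<close> for every string
  \<open>S\<close>, and by completeness the sum of the right-hand sides is \<open>2 ^ n\<close>
  times the trace of \<open>A\<close> times the identity. The number of strings enters only as a
  nonzero divisor.\<close>

lemma pauli_commutant_scalar: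
  assumes A: "A \<in> carrier_mat (2 ^ n) (2 ^ n)"
    and comm: "\<And>xs. xs \<in> pauli_strings n \<Longrightarrow> pauli_string xs * A = A * pauli_string xs"
  shows "\<exists>c. A = c \<cdot>\<^sub>m 1\<^sub>m (2 ^ n)"
proof -
  let ?N = "2 ^ n :: nat" and ?K = "of_nat (card (pauli_strings n)) :: complex"
  have K: "?K \<noteq> 0" using pauli_strings_nonempty[of n] by (auto simp: card_eq_0_iff)
  have eq: "?K * A $$ (i,l) = (if i = l then 2 ^ n * mtrace A else 0)" if il: "i < ?N" "l < ?N" for i l
  proof -
    have "?K * A $$ (i,l) = (\<Sum>xs\<in>pauli_strings n. A $$ (i,l))" by simp
    also have "\<dots> = (\<Sum>xs\<in>pauli_strings n. \<Sum>j<?N. \<Sum>k<?N.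
        (cnj (pauli_string xs $$ (l,k)) * pauli_string xs $$ (i,j)) * A $$ (j,k))"
    proof (rule sum.cong[OF refl])
      fix xs assume xs: "xs \<in> pauli_strings n"
      let ?S = "pauli_string xs"
      have S: "?S \<in> carrier_mat ?N ?N" using xs by simp
      have "A = A * (?S * ?S)"
        using A xs by (simp add: pauli_string_square pauli_strings_length)
      also have "\<dots> = ?S * A * ?S"
        using A S by (simp add: comm[OF xs] assoc_mult_mat[of _ ?N ?N _ ?N _ ?N])
      \<comment> \<open>Writing the second factor as an adjoint produces the conjugated entry that
        the completeness relation expects.\<close>
      finally have "A $$ (i,l) = (?S * A * adj ?S) $$ (i,l)" by (simp add: pauli_string_adj)
      also have "\<dots> = (\<Sum>k<?N. (\<Sum>j<?N. ?S $$ (i,j) * A $$ (j,k)) * cnj (?S $$ (l,k)))"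
        using il A S by (simp add: scalar_prod_def atLeast0LessThan)
      also have "\<dots> = (\<Sum>j<?N. \<Sum>k<?N. (cnj (?S $$ (l,k)) * ?S $$ (i,j)) * A $$ (j,k))"
        by (subst sum.swap) (simp add: sum_distrib_left sum_distrib_right mult_ac)
      finally show "A $$ (i,l) = \<dots>" .
    qed
    also have "\<dots> = (\<Sum>j<?N. \<Sum>k<?N. (\<Sum>xs\<in>pauli_strings n.
        cnj (pauli_string xs $$ (l,k)) * pauli_string xs $$ (i,j)) * A $$ (j,k))"
      by (subst sum.swap, intro sum.cong refl, subst sum.swap) (simp add: sum_distrib_right)
    also have "\<dots> = (\<Sum>j<?N. \<Sum>k<?N. if k = j then (if i = l then 2 ^ n * A $$ (j,j) else 0) else 0)"
      using il by (intro sum.cong refl) (auto simp: pauli_string_complete)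
    also have "\<dots> = (if i = l then 2 ^ n * mtrace A else 0)"
      using A by (simp add: mtrace_def sum_distrib_left)
    finally show ?thesis .
  qed
  have "A = (2 ^ n * mtrace A / ?K) \<cdot>\<^sub>m 1\<^sub>m ?N"
  proof (rule eq_matI)
    fix i j assume "i < dim_row ((2 ^ n * mtrace A / ?K) \<cdot>\<^sub>m 1\<^sub>m ?N)" "j < dim_col ((2 ^ n * mtrace A / ?K) \<cdot>\<^sub>m 1\<^sub>m ?N)"
    then have ij: "i < ?N" "j < ?N" by auto
    show "A $$ (i, j) = ((2 ^ n * mtrace A / ?K) \<cdot>\<^sub>m 1\<^sub>m ?N) $$ (i, j)"
      using eq[OF ij] K ij by (auto simp: field_simps)
  qed (use A in auto)
  then show ?thesis by blast
qed

section \<open>The Pauli group\<close>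

lemma smult_one_mat: "1 \<cdot>\<^sub>m A = (A :: complex mat)"
  by (rule eq_matI) simp_all

lemma smult_smult_mat: "a \<cdot>\<^sub>m (b \<cdot>\<^sub>m A) = (a * b) \<cdot>\<^sub>m (A :: complex mat)"
  by (rule eq_matI) simp_all

lemma pauli_groupE:
  assumes "g \<in> pauli_group n"
  obtains k xs where "k < 4" "xs \<in> pauli_strings n" "g = \<i> ^ k \<cdot>\<^sub>m pauli_string xs"
  using assms by (auto simp: pauli_group_def pauli_strings_def)

lemma pauli_groupI: "xs \<in> pauli_strings n \<Longrightarrow> \<i> ^ k \<cdot>\<^sub>m pauli_string xs \<in> pauli_group n"
  unfolding pauli_group_def pauli_strings_def
  by (auto intro!: exI[of _ "k mod 4"] exI[of _ xs] simp: i_power_mod_4)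

lemma pauli_group_string: "xs \<in> pauli_strings n \<Longrightarrow> pauli_string xs \<in> pauli_group n"
  using pauli_groupI[of xs n 0] by (simp add: smult_one_mat)

lemma finite_pauli_group [simp]: "finite (pauli_group n)"
proof -
  have "pauli_group n \<subseteq> (\<lambda>(k,xs). \<i> ^ k \<cdot>\<^sub>m pauli_string xs) ` ({..<4} \<times> pauli_strings n)"
    by (auto elim!: pauli_groupE intro!: image_eqI[where x = "(_,_)"])
  then show ?thesis by (rule finite_subset) simp
qed

lemma pauli_group_one: "1\<^sub>m (2 ^ n) \<in> pauli_group n"
  using pauli_group_string[OF pauli_strings_nonempty] by (simp add: pauli_string_zero)

lemma card_pauli_group_pos: "card (pauli_group n) > 0"
  using pauli_group_one[of n] by (auto simp: card_gt_0_iff)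

text \<open>Expresses the conjugate phase as a power of the imaginary unit again, so that
  \<open>pauli_groupI\<close> applies to adjoints.\<close>

lemma cnj_i_power: "cnj (\<i> ^ k) = \<i> ^ (3 * k)"
proof -
  have "cnj \<i> = \<i> ^ 3" by (simp add: i_power_cube)
  then show ?thesis by (metis complex_cnj_power power_mult)
qed

lemma i_power_cnj: "\<i> ^ k * cnj (\<i> ^ k) = 1"
  by (simp flip: power_mult_distrib)

lemma pauli_group_adj:
  assumes "g \<in> pauli_group n" shows "adj g \<in> pauli_group n"
  using assms
  by (auto elim!: pauli_groupE simp: adj_smult pauli_string_adj cnj_i_power pauli_groupI
      simp del: complex_cnj_power)

lemma unitary_smult:
  assumes "unitary_mat d U" "c * cnj c = 1" shows "unitary_mat d (c \<cdot>\<^sub>m U)"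
proof -
  have "c \<cdot>\<^sub>m (cnj c \<cdot>\<^sub>m A) = A" "cnj c \<cdot>\<^sub>m (c \<cdot>\<^sub>m A) = A" for A
    using assms(2) by (simp_all add: smult_smult_mat smult_one_mat mult.commute[of "cnj c"])
  then show ?thesis using unitary_matD[OF assms(1)]
    by (simp add: unitary_mat_def adj_smult mult_smult_assoc_mat[of _ d d _ d] mult_smult_distrib[of _ d d _ d])
qed

lemma pauli_string_unitary: "xs \<in> pauli_strings n \<Longrightarrow> unitary_mat (2 ^ n) (pauli_string xs)"
  using pauli_string_carrier'[of xs n] pauli_string_square[of xs]
  by (simp add: unitary_mat_def pauli_string_adj pauli_strings_length)

lemma pauli_group_unitary: "g \<in> pauli_group n \<Longrightarrow> unitary_mat (2 ^ n) g"
  by (erule pauli_groupE) (simp del: complex_cnj_power add: unitary_smult pauli_string_unitary i_power_cnj)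

lemma pauli_group_carrier [simp]: "g \<in> pauli_group n \<Longrightarrow> g \<in> carrier_mat (2 ^ n) (2 ^ n)"
  by (rule unitary_matD(1)[OF pauli_group_unitary])

lemma pauli_group_mult:
  assumes "g \<in> pauli_group n" "h \<in> pauli_group n" shows "g * h \<in> pauli_group n"
proof -
  obtain k xs where g: "xs \<in> pauli_strings n" "g = \<i> ^ k \<cdot>\<^sub>m pauli_string xs"
    using assms(1) by (rule pauli_groupE)
  obtain l ys where h: "ys \<in> pauli_strings n" "h = \<i> ^ l \<cdot>\<^sub>m pauli_string ys"
    using assms(2) by (rule pauli_groupE)
  obtain m zs where z: "zs \<in> pauli_strings n" "pauli_string xs * pauli_string ys = \<i> ^ m \<cdot>\<^sub>m pauli_string zs"
    using pauli_string_mult[OF g(1) h(1)] by blast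
  let ?N = "2 ^ n"
  have "g * h = (\<i> ^ k * \<i> ^ l) \<cdot>\<^sub>m (pauli_string xs * pauli_string ys)"
    using g h by (simp add: smult_smult_mat mult.commute mult_smult_assoc_mat[of _ ?N ?N _ ?N] mult_smult_distrib[of _ ?N ?N _ ?N])
  also have "\<dots> = \<i> ^ (k + l + m) \<cdot>\<^sub>m pauli_string zs"
    unfolding z by (simp add: smult_smult_mat power_add)
  finally show ?thesis using pauli_groupI[OF z(1)] by simp
qed

text \<open>Different strings are orthogonal, and equal strings with different phases have phase
  ratio i, -1 or -i. In all cases the real part of the inner product is at most 0, so the squared
  distance is at least the sum of the two squared norms.\<close>

lemma pauli_group_separated:
  assumes "g \<in> pauli_group n" "h \<in> pauli_group n" "g \<noteq> h"
  shows "(hs_norm (g - h))\<^sup>2 \<ge> 2 * 2 ^ n"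
proof -
  obtain k xs where g: "k < 4" "xs \<in> pauli_strings n" "g = \<i> ^ k \<cdot>\<^sub>m pauli_string xs"
    using assms(1) by (rule pauli_groupE)
  obtain l ys where h: "l < 4" "ys \<in> pauli_strings n" "h = \<i> ^ l \<cdot>\<^sub>m pauli_string ys"
    using assms(2) by (rule pauli_groupE)
  let ?N = "2 ^ n :: nat"
  have ip: "hs_inner g h = cnj (\<i> ^ k) * \<i> ^ l * (if xs = ys then 2 ^ n else 0)"
    using g h by (simp add: hs_inner_smult_left[of _ ?N ?N] hs_inner_smult_right[of _ ?N ?N] pauli_string_orthogonal)
  have "Re (hs_inner g h) \<le> 0"
  proof (cases "xs = ys")
    case True
    then have "k \<noteq> l" using assms(3) g h by auto
    then have "Re (cnj (\<i> ^ k) * \<i> ^ l) \<le> 0"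
      using less_4_cases[OF g(1)] less_4_cases[OF h(1)] by (elim disjE; simp add: i_power_cube)
    moreover have "Re (cnj (\<i> ^ k) * \<i> ^ l * 2 ^ n) = Re (cnj (\<i> ^ k) * \<i> ^ l) * 2 ^ n"
    proof -
      have "(2 ^ n :: complex) = of_real (2 ^ n)" by simp
      then show ?thesis by (simp only: Re_complex_of_real Im_complex_of_real times_complex.sel mult_zero_right diff_zero)
    qed
    ultimately show ?thesis using True by (simp add: ip mult_nonpos_nonneg)
  qed (simp add: ip)
  then show ?thesis
    using hs_norm_diff_square[of g ?N ?N h] hs_norm_unitary_square[OF pauli_group_unitary[OF assms(1)]]
      hs_norm_unitary_square[OF pauli_group_unitary[OF assms(2)]] assms by simp
qed

lemma pauli_group_mult_bij:
  assumes h: "h \<in> pauli_group n" shows "bij_betw (\<lambda>g. h * g) (pauli_group n) (pauli_group n)"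
proof -
  have "inj_on (\<lambda>g. h * g) (pauli_group n)"
  proof (rule inj_onI)
    fix a b assume ab: "a \<in> pauli_group n" "b \<in> pauli_group n" "h * a = h * b"
    then have "adj h * (h * a) = adj h * (h * b)" by simp
    then show "a = b"
      using unitary_cancel_left(1)[OF pauli_group_unitary[OF h] pauli_group_carrier[OF ab(1)]]
        unitary_cancel_left(1)[OF pauli_group_unitary[OF h] pauli_group_carrier[OF ab(2)]] by simp
  qed
  moreover have "(\<lambda>g. h * g) ` pauli_group n \<subseteq> pauli_group n" using pauli_group_mult[OF h] by blast
  ultimately show ?thesis by (simp add: bij_betw_def endo_inj_surj)
qed

text \<open>Pigeonhole: \<open>S\<close> and its image under \<open>s\<close> to
  \<open>g * adj s\<close> each fill more than half of the group, so they meet, and a common element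
  \<open>s = g * adj t\<close> gives the factorisation.\<close>

lemma pauli_group_majority_product:
  assumes S: "S \<subseteq> pauli_group n" "2 * card S > card (pauli_group n)" and g: "g \<in> pauli_group n"
  obtains s t where "s \<in> S" "t \<in> S" "g = s * t"
proof -
  let ?f = "\<lambda>s. g * adj s"
  have inj: "inj_on ?f S"
  proof (rule inj_onI)
    fix a b assume ab: "a \<in> S" "b \<in> S" "g * adj a = g * adj b"
    then have c: "adj a \<in> carrier_mat (2^n) (2^n)" "adj b \<in> carrier_mat (2^n) (2^n)" using S by auto
    have "adj g * (g * adj a) = adj g * (g * adj b)" using ab by simp
    then have "adj a = adj b"
      using c unitary_cancel_left(1)[OF pauli_group_unitary[OF g]] by metis
    then show "a = b" by (metis adj_adj)
  qed
  have sub: "?f ` S \<subseteq> pauli_group n" using S g by (auto intro: pauli_group_mult pauli_group_adj)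
  have fin: "finite S" using S(1) finite_subset by fastforce
  have "S \<inter> ?f ` S \<noteq> {}"
  proof
    assume "S \<inter> ?f ` S = {}"
    then have "card (S \<union> ?f ` S) = 2 * card S"
      using fin inj by (simp add: card_Un_disjoint card_image)
    moreover have "card (S \<union> ?f ` S) \<le> card (pauli_group n)"
      using S sub by (intro card_mono) auto
    ultimately show False using S by simp
  qed
  then obtain s t where st: "s \<in> S" "t \<in> S" "s = g * adj t" by auto
  have t: "unitary_mat (2 ^ n) t" using st S pauli_group_unitary by blast
  have "s * t = g * (adj t * t)"
    using st t g unitary_matD(1)[OF t] by (simp add: assoc_mult_mat[of _ "2^n" "2^n" _ "2^n" _ "2^n"])
  then have "g = s * t" using right_mult_one_mat[OF pauli_group_carrier[OF g]] unitary_matD[OF t] by simp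
  then show ?thesis using that st by blast
qed

section \<open>Rounding a unitary to a Clifford unitary\<close>

text \<open>The dimension is an explicit argument because the value of an empty sum, the zero
  matrix, depends on it.\<close>

definition matsum :: "nat \<Rightarrow> 'a set \<Rightarrow> ('a \<Rightarrow> complex mat) \<Rightarrow> complex mat" where
  "matsum N S F = mat N N (\<lambda>p. \<Sum>g\<in>S. F g $$ p)"

lemma matsum_carrier [simp]: "matsum N S F \<in> carrier_mat N N"
  by (simp add: matsum_def)

lemma matsum_cong: "(\<And>g. g \<in> S \<Longrightarrow> F g = G g) \<Longrightarrow> matsum N S F = matsum N S G"
  by (simp add: matsum_def cong: sum.cong)

lemma mult_matsum:
  assumes "A \<in> carrier_mat N N" "\<And>g. g \<in> S \<Longrightarrow> F g \<in> carrier_mat N N"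
  shows "A * matsum N S F = matsum N S (\<lambda>g. A * F g)"
proof (rule eq_matI)
  fix i j assume "i < dim_row (matsum N S (\<lambda>g. A * F g))" "j < dim_col (matsum N S (\<lambda>g. A * F g))"
  then have ij: "i < N" "j < N" by (auto simp: matsum_def)
  have "(A * matsum N S F) $$ (i,j) = (\<Sum>k<N. \<Sum>g\<in>S. A $$ (i,k) * F g $$ (k,j))"
    using assms(1) ij by (simp add: matsum_def scalar_prod_def atLeast0LessThan sum_distrib_left)
  also have "\<dots> = (\<Sum>g\<in>S. (A * F g) $$ (i,j))"
    using assms ij
    by (subst sum.swap) (auto simp: scalar_prod_def atLeast0LessThan dest!: assms(2) intro!: sum.cong)
  finally show "(A * matsum N S F) $$ (i,j) = matsum N S (\<lambda>g. A * F g) $$ (i,j)"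
    using ij by (simp add: matsum_def)
qed (use assms in \<open>auto simp: matsum_def\<close>)

lemma matsum_mult:
  assumes "A \<in> carrier_mat N N" "\<And>g. g \<in> S \<Longrightarrow> F g \<in> carrier_mat N N"
  shows "matsum N S F * A = matsum N S (\<lambda>g. F g * A)"
proof (rule eq_matI)
  fix i j assume "i < dim_row (matsum N S (\<lambda>g. F g * A))" "j < dim_col (matsum N S (\<lambda>g. F g * A))"
  then have ij: "i < N" "j < N" by (auto simp: matsum_def)
  have "(matsum N S F * A) $$ (i,j) = (\<Sum>k<N. \<Sum>g\<in>S. F g $$ (i,k) * A $$ (k,j))"
    using assms(1) ij by (simp add: matsum_def scalar_prod_def atLeast0LessThan sum_distrib_right)
  also have "\<dots> = (\<Sum>g\<in>S. (F g * A) $$ (i,j))"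
    using assms ij
    by (subst sum.swap) (auto simp: scalar_prod_def atLeast0LessThan dest!: assms(2) intro!: sum.cong)
  finally show "(matsum N S F * A) $$ (i,j) = matsum N S (\<lambda>g. F g * A) $$ (i,j)"
    using ij by (simp add: matsum_def)
qed (use assms in \<open>auto simp: matsum_def\<close>)

lemma matsum_reindex: "bij_betw f S S \<Longrightarrow> matsum N S (\<lambda>g. F (f g)) = matsum N S F"
  unfolding matsum_def by (intro arg_cong[where f = "mat N N"] ext sum.reindex_bij_betw)

lemma hs_inner_matsum_right:
  assumes "A \<in> carrier_mat N N"
  shows "hs_inner A (matsum N S F) = (\<Sum>g\<in>S. hs_inner A (F g))"
proof -
  have "hs_inner A (matsum N S F) = (\<Sum>i<N. \<Sum>j<N. \<Sum>g\<in>S. cnj (A $$ (i,j)) * F g $$ (i,j))"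
    using assms by (simp add: hs_inner_def matsum_def sum_distrib_left)
  also have "\<dots> = (\<Sum>i<N. \<Sum>g\<in>S. \<Sum>j<N. cnj (A $$ (i,j)) * F g $$ (i,j))"
    by (intro sum.cong refl sum.swap)
  also have "\<dots> = (\<Sum>g\<in>S. \<Sum>i<N. \<Sum>j<N. cnj (A $$ (i,j)) * F g $$ (i,j))"
    by (rule sum.swap)
  finally show ?thesis using assms by (simp add: hs_inner_def)
qed


lemma hs_inner_adj: "hs_inner (adj A) (adj B) = cnj (hs_inner A B)"
  if "A \<in> carrier_mat m n" "B \<in> carrier_mat m n"
  using that unfolding hs_inner_def by (subst sum.swap) simp

lemma conj_unitary:
  assumes "unitary_mat N U" "unitary_mat N g" shows "unitary_mat N (U * g * adj U)"
  using assms by (intro unitary_mat_mult unitary_mat_adj)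

lemma conj_mult:
  assumes U: "unitary_mat N U" and g: "g \<in> carrier_mat N N" and h: "h \<in> carrier_mat N N"
  shows "U * (g * h) * adj U = U * g * adj U * (U * h * adj U)"
  using unitary_matD(1)[OF U] g h unitary_cancel_left(1)[OF U, where k = N]
  by (simp add: assoc_mult_mat[of _ N N _ N _ N])

section \<open>The collision statistic and the nearest Pauli operator\<close>

text \<open>Probability that two independent Pauli-basis measurements of the Choi state of
  \<open>U * g * adj U\<close> agree: each outcome has the squared normalised coefficient as its
  probability, and squaring once more gives the fourth power.\<close>

definition collision :: "nat \<Rightarrow> complex mat \<Rightarrow> complex mat \<Rightarrow> real" where
  "collision n U g = (\<Sum>xs\<in>pauli_strings n. (cmod (hs_inner (pauli_string xs) (U * g * adj U)) / 2 ^ n) ^ 4)"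

text \<open>A collision probability is at most the largest single probability, which is the square
  of the largest normalised coefficient \<open>c x\<close> and hence at most \<open>c x\<close>. The
  phase can then be corrected inside the group, because \<open>U * g * adj U\<close> is a power of
  the imaginary unit times a Hermitian matrix.\<close>

lemma collision_overlap:
  assumes U: "unitary_mat (2 ^ n) U" and g: "g \<in> pauli_group n"
  shows "\<exists>h\<in>pauli_group n. 2 ^ n * collision n U g \<le> Re (hs_inner h (U * g * adj U))"
proof -
  let ?N = "2 ^ n :: nat" and ?B = "U * g * adj U" and ?S = "pauli_strings n"
  define c where "c xs = cmod (hs_inner (pauli_string xs) ?B) / 2 ^ n" for xs
  note Uc = unitary_matD(1)[OF U]
  have B: "unitary_mat ?N ?B" using conj_unitary[OF U pauli_group_unitary[OF g]] .
  have c0: "c xs \<ge> 0" for xs by (simp add: c_def)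
  have sum_c: "(\<Sum>xs\<in>?S. (c xs)\<^sup>2) = 1"
  proof -
    have "(\<Sum>xs\<in>?S. (c xs)\<^sup>2) = (\<Sum>xs\<in>?S. (cmod (hs_inner (pauli_string xs) ?B))\<^sup>2) / (2 ^ n)\<^sup>2"
      by (simp add: c_def power_divide sum_divide_distrib)
    then show ?thesis
      using pauli_string_parseval[OF unitary_matD(1)[OF B]] hs_norm_unitary_square[OF B]
      by (simp add: power2_eq_square)
  qed
  have ne: "?S \<noteq> {}" using pauli_strings_nonempty by blast
  define m where "m = Max (c ` ?S)"
  have "m \<in> c ` ?S" unfolding m_def using ne by (intro Max_in) auto
  then obtain x where x: "x \<in> ?S" "c x = m" by auto
  have max: "c y \<le> c x" if "y \<in> ?S" for y unfolding x(2) m_def using that by (intro Max_ge) auto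
  have "(c x)\<^sup>2 \<le> (\<Sum>xs\<in>?S. (c xs)\<^sup>2)" using x by (intro member_le_sum) auto
  then have "(c x)\<^sup>2 \<le> 1\<^sup>2" using sum_c by simp
  then have "c x \<le> 1" by (rule power2_le_imp_le) simp
  have "collision n U g = (\<Sum>xs\<in>?S. (c xs)\<^sup>2 * (c xs)\<^sup>2)"
    unfolding collision_def c_def by (simp add: power2_eq_square power4_eq_xxxx mult_ac)
  also have "\<dots> \<le> (\<Sum>xs\<in>?S. (c x)\<^sup>2 * (c xs)\<^sup>2)"
    using max c0 by (intro sum_mono mult_right_mono power_mono) auto
  also have "\<dots> = (c x)\<^sup>2" by (simp add: sum_c flip: sum_distrib_left)
  also have "\<dots> \<le> c x" using c0[of x] \<open>c x \<le> 1\<close> by (simp add: power2_eq_square mult_left_le)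
  finally have le: "2 ^ n * collision n U g \<le> cmod (hs_inner (pauli_string x) ?B)"
    by (simp add: c_def field_simps)
  obtain k ys where y: "ys \<in> ?S" "g = \<i> ^ k \<cdot>\<^sub>m pauli_string ys" using g by (rule pauli_groupE)
  define z where "z = hs_inner (pauli_string x) (U * pauli_string ys * adj U)"
  have Cc: "U * pauli_string ys * adj U \<in> carrier_mat ?N ?N"
    using Uc y by (intro mult_square_carrier) auto
  have adjC: "adj (U * pauli_string ys * adj U) = U * pauli_string ys * adj U"
    using Uc y by (simp add: adj_mult[of _ ?N ?N _ ?N] pauli_string_adj assoc_mult_mat[of _ ?N ?N _ ?N _ ?N])
  \<comment> \<open>Both arguments of this inner product are self-adjoint, so it is real. Only its
    sign is unknown, and the exponents \<open>k\<close> and \<open>k + 2\<close> cover the two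
    signs.\<close>
  have "cnj z = z"
    using hs_inner_adj[OF pauli_string_carrier'[OF x(1)] Cc] unfolding z_def by (simp add: pauli_string_adj adjC)
  then have zr: "z = of_real (Re z)" by (simp add: complex_eq_iff)
  have Beq: "?B = \<i> ^ k \<cdot>\<^sub>m (U * pauli_string ys * adj U)"
    using Uc y by (simp add: mult_smult_assoc_mat[of _ ?N ?N _ ?N] mult_smult_distrib[of _ ?N ?N _ ?N])
  have ip: "hs_inner (\<i> ^ l \<cdot>\<^sub>m pauli_string x) ?B = cnj (\<i> ^ l) * \<i> ^ k * z" for l
    unfolding Beq z_def using Cc x(1)
    by (simp add: hs_inner_smult_left[of _ ?N ?N] hs_inner_smult_right[of _ ?N ?N])
  have "cmod (hs_inner (pauli_string x) ?B) = \<bar>Re z\<bar>"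
    using ip[of 0] zr by (metis complex_cnj_one mult_1 norm_ii norm_mult norm_of_real norm_power power_0 power_one smult_one_mat)
  moreover have "hs_inner (\<i> ^ k \<cdot>\<^sub>m pauli_string x) ?B = z"
    unfolding ip using i_power_cnj[of k] by (simp add: mult.commute)
  moreover have "hs_inner (\<i> ^ (k + 2) \<cdot>\<^sub>m pauli_string x) ?B = - z"
    unfolding ip using i_power_cnj[of k] by (simp add: mult.commute power_add)
  ultimately have "\<exists>l. 2 ^ n * collision n U g \<le> Re (hs_inner (\<i> ^ l \<cdot>\<^sub>m pauli_string x) ?B)"
    using le by (cases "Re z \<ge> 0") (auto intro: exI[of _ k] exI[of _ "k + 2"])
  then show ?thesis using pauli_groupI[OF x(1)] by blast
qed

lemma hs_norm_unitary_diff: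
  assumes "unitary_mat N A" "unitary_mat N B"
  shows "(hs_norm (A - B))\<^sup>2 = 2 * N - 2 * Re (hs_inner A B)"
  using hs_norm_diff_square[OF unitary_matD(1)[OF assms(1)] unitary_matD(1)[OF assms(2)]]
    hs_norm_unitary_square[OF assms(1)] hs_norm_unitary_square[OF assms(2)] by simp

text \<open>Telescoping through \<open>C * B\<close>: unitary factors preserve the norm, so the
  errors of the two factors simply add.\<close>

lemma hs_norm_diff_mult:
  assumes "unitary_mat N A" "unitary_mat N B" "unitary_mat N C" "unitary_mat N D"
  shows "hs_norm (A * B - C * D) \<le> hs_norm (A - C) + hs_norm (B - D)"
proof -
  note c = assms[THEN unitary_matD(1)]
  have "hs_norm (A * B - C * D) \<le> hs_norm (A * B - C * B) + hs_norm (C * B - C * D)"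
    using c by (intro hs_norm_triangle[of _ N N]) auto
  also have "A * B - C * B = (A - C) * B" using c by (simp add: minus_mult_distrib_mat[of _ N N])
  also have "C * B - C * D = C * (B - D)" using c by (simp add: mult_minus_distrib_mat[of _ N N])
  finally show ?thesis
    using hs_norm_mult_unitary_right[OF assms(2), of "A - C"] hs_norm_mult_unitary_left[OF assms(3), of "B - D"] c
    by (simp add: minus_carrier_mat)
qed

text \<open>Once \<open>adj V * V\<close> is known to be scalar, its trace fixes the scalar as the
  squared norm of \<open>V\<close> over \<open>2 ^ n\<close>, which explains the rescaling. The
  rescaled matrix \<open>W\<close> still intertwines, so \<open>W * g * adj W\<close> is
  \<open>T g\<close>.\<close>

lemma clifford_of_intertwiner:
  assumes V: "V \<in> carrier_mat (2 ^ n) (2 ^ n)" and nz: "hs_norm V > 0"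
    and T: "\<And>g. g \<in> pauli_group n \<Longrightarrow> T g \<in> pauli_group n"
    and inter: "\<And>g. g \<in> pauli_group n \<Longrightarrow> T g * V = V * g"
  shows "of_real (sqrt (2 ^ n) / hs_norm V) \<cdot>\<^sub>m V \<in> clifford_group n"
proof -
  let ?N = "2 ^ n :: nat" and ?r = "sqrt (2 ^ n) / hs_norm V"
  define W where "W = complex_of_real ?r \<cdot>\<^sub>m V"
  have Wc: "W \<in> carrier_mat ?N ?N" using V by (simp add: W_def)
  \<comment> \<open>The intertwining relation in the opposite direction, obtained by cancelling the
    unitaries \<open>T g\<close> and \<open>g\<close> and then taking adjoints. Both directions are
    needed to move a Pauli string through \<open>adj V * V\<close>.\<close>
  have adj_inter: "adj V * T g = g * adj V" if g: "g \<in> pauli_group n" for g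
  proof -
    have ga: "adj g \<in> carrier_mat ?N ?N" and tc: "T g \<in> carrier_mat ?N ?N" and gc: "g \<in> carrier_mat ?N ?N"
      using T[OF g] g by auto
    have "adj (T g) * V = adj (T g) * (V * g * adj g)"
      using unitary_matD(3)[OF pauli_group_unitary[OF g]] V gc ga
      by (simp add: assoc_mult_mat[of _ ?N ?N _ ?N _ ?N])
    also have "\<dots> = adj (T g) * (T g * (V * adj g))"
      using V tc ga by (simp add: inter[OF g, symmetric] assoc_mult_mat[of _ ?N ?N _ ?N _ ?N])
    also have "\<dots> = V * adj g"
      using V ga by (intro unitary_cancel_left[OF pauli_group_unitary[OF T[OF g]]]) (rule mult_square_carrier)
    finally have "adj (adj (T g) * V) = adj (V * adj g)" by simp
    then show ?thesis using V tc gc by (simp add: adj_mult[of _ ?N ?N _ ?N])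
  qed
  have "\<exists>c. adj V * V = c \<cdot>\<^sub>m 1\<^sub>m ?N"
  proof (rule pauli_commutant_scalar)
    show "adj V * V \<in> carrier_mat ?N ?N" using V by simp
    fix xs assume xs: "xs \<in> pauli_strings n"
    let ?g = "pauli_string xs"
    have g: "?g \<in> pauli_group n" using pauli_group_string[OF xs] .
    then have tc: "T ?g \<in> carrier_mat ?N ?N" "?g \<in> carrier_mat ?N ?N" using T[OF g] by auto
    have "?g * (adj V * V) = adj V * T ?g * V"
      using V tc by (simp add: adj_inter[OF g] assoc_mult_mat[of _ ?N ?N _ ?N _ ?N])
    also have "\<dots> = adj V * V * ?g"
      using V tc by (simp add: inter[OF g] assoc_mult_mat[of _ ?N ?N _ ?N _ ?N])
    finally show "?g * (adj V * V) = adj V * V * ?g" .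
  qed
  then obtain c where c: "adj V * V = c \<cdot>\<^sub>m 1\<^sub>m ?N" by blast
  have "hs_inner V V = c * 2 ^ n"
    using V by (simp add: hs_inner_trace[of _ ?N ?N] c mtrace_def)
  then have c': "c = of_real ((hs_norm V)\<^sup>2 / 2 ^ n)" by (simp add: hs_inner_self field_simps)
  have "adj W * W = (of_real ?r * of_real ?r) \<cdot>\<^sub>m (adj V * V)"
    using V by (simp add: W_def adj_smult mult_smult_assoc_mat[of _ ?N ?N _ ?N]
        mult_smult_distrib[of _ ?N ?N _ ?N] smult_smult_mat)
  also have "\<dots> = of_real (?r\<^sup>2 * ((hs_norm V)\<^sup>2 / 2 ^ n)) \<cdot>\<^sub>m 1\<^sub>m ?N"
    unfolding c c' smult_smult_mat by (simp only: power2_eq_square of_real_mult)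
  also have "?r\<^sup>2 * ((hs_norm V)\<^sup>2 / 2 ^ n) = 1" using nz by (simp add: power_divide)
  finally have WW: "adj W * W = 1\<^sub>m ?N" by (simp add: smult_one_mat)
  then have WW': "W * adj W = 1\<^sub>m ?N"
    \<comment> \<open>In finite dimension a left inverse is also a right inverse.\<close>
    using mat_mult_left_right_inverse[of "adj W" ?N W] Wc by simp
  have "W * g * adj W \<in> pauli_group n" if g: "g \<in> pauli_group n" for g
  proof -
    have tc: "T g \<in> carrier_mat ?N ?N" "g \<in> carrier_mat ?N ?N" using T[OF g] g by auto
    have "W * g = T g * W"
      using V tc by (simp add: W_def inter[OF g] mult_smult_assoc_mat[of _ ?N ?N _ ?N] mult_smult_distrib[of _ ?N ?N _ ?N])
    then have "W * g * adj W = T g * (W * adj W)"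
      using Wc tc by (simp add: assoc_mult_mat[of _ ?N ?N _ ?N _ ?N])
    then show ?thesis using T[OF g] tc by (simp add: WW')
  qed
  then show ?thesis using Wc WW WW'
    unfolding W_def[symmetric] by (simp add: clifford_group_def unitaries_def unitary_mat_def)
qed

text \<open>Every conjugate is within \<open>2 R\<close> of a Pauli operator, where \<open>R\<^sup>2 = 2 ^ n / 20\<close>, because a
  majority subset of the group generates it in two factors; as \<open>(6 R)\<^sup>2 < 2 \<cdot> 2 ^ n\<close>, this nearest
  Pauli operator is unique and depends multiplicatively on the group element.\<close>

lemma conjugation_rounding:
  assumes U: "unitary_mat (2 ^ n) U"
    and small: "(\<Sum>g\<in>pauli_group n. 1 - collision n U g) < card (pauli_group n) / 80"
  obtains T where "\<And>g. g \<in> pauli_group n \<Longrightarrow> T g \<in> pauli_group n"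
    "\<And>g h. g \<in> pauli_group n \<Longrightarrow> h \<in> pauli_group n \<Longrightarrow> T (g * h) = T g * T h"
    "\<And>g. g \<in> pauli_group n \<Longrightarrow>
       1 - Re (hs_inner (U * g * adj U) (T g)) / 2 ^ n \<le> 4 * (1 - collision n U g)"
proof -
  let ?N = "2 ^ n :: nat" and ?G = "pauli_group n"
  define c where "c g = U * g * adj U" for g
  define R where "R = sqrt (2 ^ n / 20)"
  have R0: "R > 0" and R2: "R\<^sup>2 = 2 ^ n / 20" by (simp_all add: R_def)
  have cu: "unitary_mat ?N (c g)" if "g \<in> ?G" for g
    unfolding c_def using conj_unitary[OF U pauli_group_unitary[OF that]] .
  have ccar: "c g \<in> carrier_mat ?N ?N" if "g \<in> ?G" for g using unitary_matD(1)[OF cu[OF that]] .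
  have near: "\<exists>h\<in>?G. (hs_norm (c g - h))\<^sup>2 \<le> 2 * 2 ^ n * (1 - collision n U g)" if g: "g \<in> ?G" for g
  proof -
    obtain h where h: "h \<in> ?G" "2 ^ n * collision n U g \<le> Re (hs_inner h (c g))"
      using collision_overlap[OF U g] unfolding c_def by blast
    have "Re (hs_inner (c g) h) = Re (hs_inner h (c g))"
      using hs_inner_commute[OF ccar[OF g] pauli_group_carrier[OF h(1)]] by simp
    then show ?thesis
      using h hs_norm_unitary_diff[OF cu[OF g] pauli_group_unitary[OF h(1)]]
      by (intro bexI[OF _ h(1)]) (simp add: algebra_simps)
  qed
  \<comment> \<open>Nonnegativity of the squared distance in \<open>near\<close> already forces this
    bound.\<close>
  have le1: "collision n U g \<le> 1" if "g \<in> ?G" for g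
  proof (rule ccontr)
    assume "\<not> collision n U g \<le> 1"
    then have "2 * 2 ^ n * (1 - collision n U g) < 0" by (simp add: mult_pos_neg)
    then show False using near[OF that] by (meson not_le order_trans zero_le_power2)
  qed
  \<comment> \<open>The threshold 1/40 serves twice: \<open>2 * 2 ^ n / 40\<close> is the square of
    \<open>R\<close>, and it is twice the assumed average bound 1/80.\<close>
  define S where "S = {g\<in>?G. collision n U g \<ge> 39/40}"
  have S: "\<exists>h\<in>?G. hs_norm (c g - h) \<le> R" if "g \<in> S" for g
  proof -
    have g: "g \<in> ?G" "1 - collision n U g \<le> 1/40" using that by (auto simp: S_def)
    obtain h where h: "h \<in> ?G" "(hs_norm (c g - h))\<^sup>2 \<le> 2 * 2 ^ n * (1 - collision n U g)"
      using near[OF g(1)] by blast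
    have "2 * 2 ^ n * (1 - collision n U g) \<le> 2 * 2 ^ n * (1/40)"
      using g(2) by (intro mult_left_mono) auto
    then have "(hs_norm (c g - h))\<^sup>2 \<le> 2 * 2 ^ n * (1/40)" using h(2) by (rule order_trans[rotated])
    then have "(hs_norm (c g - h))\<^sup>2 \<le> R\<^sup>2" using R2 by simp
    then have "hs_norm (c g - h) \<le> R" by (rule power2_le_imp_le) (use R0 in simp)
    then show ?thesis using h by blast
  qed
  \<comment> \<open>Markov's inequality: an average below 1/80 leaves less than half of the group
    with a deficit above 1/40.\<close>
  have majority: "2 * card S > card ?G"
  proof -
    have "card (?G - S) * (1/40) = (\<Sum>g\<in>?G - S. 1/40::real)" by simp
    also have "\<dots> \<le> (\<Sum>g\<in>?G - S. 1 - collision n U g)" by (intro sum_mono) (auto simp: S_def)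
    also have "\<dots> \<le> (\<Sum>g\<in>?G. 1 - collision n U g)" using le1 by (intro sum_mono2) auto
    finally have "real (card (?G - S)) * (1/40) < card ?G / 80" using small by simp
    moreover have "card (?G - S) = card ?G - card S" "card S \<le> card ?G"
      by (auto simp: S_def intro: card_Diff_subset card_mono)
    ultimately show ?thesis by (simp add: of_nat_diff)
  qed
  have ex: "\<exists>h\<in>?G. hs_norm (c g - h) \<le> 2 * R" if g: "g \<in> ?G" for g
  proof -
    obtain s t where st: "s \<in> S" "t \<in> S" "g = s * t"
      using pauli_group_majority_product[OF _ majority g] by (auto simp: S_def)
    then have G: "s \<in> ?G" "t \<in> ?G" by (auto simp: S_def)
    obtain h where h: "h \<in> ?G" "hs_norm (c s - h) \<le> R" using S[OF st(1)] by blast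
    obtain k where k: "k \<in> ?G" "hs_norm (c t - k) \<le> R" using S[OF st(2)] by blast
    have "c g = c s * c t"
      unfolding c_def st(3) using G by (intro conj_mult[OF U]) auto
    then have "hs_norm (c g - h * k) \<le> 2 * R"
      using hs_norm_diff_mult[OF cu[OF G(1)] cu[OF G(2)] pauli_group_unitary[OF h(1)] pauli_group_unitary[OF k(1)]]
        h k by simp
    then show ?thesis using pauli_group_mult[OF h(1) k(1)] by blast
  qed
  then obtain T where T: "\<And>g. g \<in> ?G \<Longrightarrow> T g \<in> ?G" "\<And>g. g \<in> ?G \<Longrightarrow> hs_norm (c g - T g) \<le> 2 * R"
    by metis
  have unique: "h = k" if hk: "h \<in> ?G" "k \<in> ?G" and A: "A \<in> carrier_mat ?N ?N"
    and close: "hs_norm (A - h) + hs_norm (A - k) \<le> 6 * R" for A h k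
  proof (rule ccontr)
    assume "h \<noteq> k"
    then have "2 * 2 ^ n \<le> (hs_norm (h - k))\<^sup>2" using pauli_group_separated[OF hk] by simp
    moreover have "hs_norm (h - k) \<le> 6 * R"
      using hs_norm_triangle[of h ?N ?N A k] hs_norm_commute[of h ?N ?N A] hk A close by simp
    then have "(hs_norm (h - k))\<^sup>2 \<le> (6 * R)\<^sup>2" using hs_norm_nonneg by (intro power_mono) auto
    moreover have "(0::real) < 2 ^ n" by simp
    ultimately show False using R2 by (simp add: power_mult_distrib)
  qed
  have mult: "T (g * h) = T g * T h" if gh: "g \<in> ?G" "h \<in> ?G" for g h
  proof (rule unique)
    show "T (g * h) \<in> ?G" "T g * T h \<in> ?G" "c (g * h) \<in> carrier_mat ?N ?N"
      using gh T(1) pauli_group_mult ccar by blast+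
    have "c (g * h) = c g * c h" unfolding c_def using gh by (intro conj_mult[OF U]) auto
    then have "hs_norm (c (g * h) - T g * T h) \<le> 4 * R"
      using hs_norm_diff_mult[OF cu[OF gh(1)] cu[OF gh(2)] pauli_group_unitary[OF T(1)[OF gh(1)]] pauli_group_unitary[OF T(1)[OF gh(2)]]]
        T(2)[OF gh(1)] T(2)[OF gh(2)] by simp
    \<comment> \<open>The budget is \<open>2 * R\<close> for the rounding of the product and
      \<open>2 * R\<close> for each of the two factors.\<close>
    then show "hs_norm (c (g * h) - T (g * h)) + hs_norm (c (g * h) - T g * T h) \<le> 6 * R"
      using T(2)[OF pauli_group_mult[OF gh]] by simp
  qed
  \<comment> \<open>For \<open>g\<close> in \<open>S\<close>, uniqueness identifies
    \<open>T g\<close> with the operator from \<open>near\<close>, which gives the bound with factor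
    1. Outside \<open>S\<close> only the radius \<open>2 * R\<close> is available: it gives at most
    1/10, which is 4 times the minimal deficit 1/40. This is the origin of the factor 4.\<close>
  have "1 - Re (hs_inner (c g) (T g)) / 2 ^ n \<le> 4 * (1 - collision n U g)" if g: "g \<in> ?G" for g
  proof -
    have d: "1 - Re (hs_inner (c g) (T g)) / 2 ^ n = (hs_norm (c g - T g))\<^sup>2 / (2 * 2 ^ n)"
      using hs_norm_unitary_diff[OF cu[OF g] pauli_group_unitary[OF T(1)[OF g]]] by (simp add: diff_divide_distrib)
    show ?thesis
    proof (cases "g \<in> S")
      case True
      obtain h where h: "h \<in> ?G" "(hs_norm (c g - h))\<^sup>2 \<le> 2 * 2 ^ n * (1 - collision n U g)"
        using near[OF g] by blast
      have "2 * 2 ^ n * (1 - collision n U g) \<le> 2 * 2 ^ n * (1/40)"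
        using True by (intro mult_left_mono) (auto simp: S_def)
      then have "(hs_norm (c g - h))\<^sup>2 \<le> 2 * 2 ^ n * (1/40)" using h(2) by (rule order_trans[rotated])
    then have "(hs_norm (c g - h))\<^sup>2 \<le> R\<^sup>2" using R2 by simp
      then have "hs_norm (c g - h) \<le> R" by (rule power2_le_imp_le) (use R0 in simp)
      then have "T g = h" using unique[OF T(1)[OF g] h(1) ccar[OF g]] T(2)[OF g] R0 by simp
      then have "1 - Re (hs_inner (c g) (T g)) / 2 ^ n \<le> 1 - collision n U g"
        using h(2) unfolding d by (simp add: field_simps)
      then show ?thesis using le1[OF g] by simp
    next
      case False
      have "(hs_norm (c g - T g))\<^sup>2 \<le> (2 * R)\<^sup>2" using T(2)[OF g] hs_norm_nonneg by (intro power_mono) auto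
      then have "1 - Re (hs_inner (c g) (T g)) / 2 ^ n \<le> 1/10"
        unfolding d using R2 by (simp add: power_mult_distrib field_simps)
      then show ?thesis using False g by (simp add: S_def)
    qed
  qed
  then show ?thesis using that[of T] T(1) mult unfolding c_def by blast
qed

text \<open>Divided by the group order, \<open>V\<close> is the orthogonal projection of
  \<open>U\<close> onto the matrices intertwining \<open>g\<close> with \<open>T g\<close>. Its
  overlap with \<open>U\<close> is thus governed by the mean \<open>lam\<close> of the overlaps of
  \<open>U * g * adj U\<close> with \<open>T g\<close>, and normalising \<open>V\<close> to a
  unitary can only increase this overlap.\<close>

theorem clifford_rounding:
  assumes U: "unitary_mat (2 ^ n) U"
    and small: "(\<Sum>g\<in>pauli_group n. 1 - collision n U g) < card (pauli_group n) / 80"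
  shows "\<exists>W\<in>clifford_group n.
    dist_phase U W \<le> sqrt (4 * (\<Sum>g\<in>pauli_group n. 1 - collision n U g) / card (pauli_group n))"
proof -
  let ?N = "2 ^ n :: nat" and ?G = "pauli_group n"
  obtain T where T: "\<And>g. g \<in> ?G \<Longrightarrow> T g \<in> ?G"
    and mult: "\<And>g h. g \<in> ?G \<Longrightarrow> h \<in> ?G \<Longrightarrow> T (g * h) = T g * T h"
    and close: "\<And>g. g \<in> ?G \<Longrightarrow> 1 - Re (hs_inner (U * g * adj U) (T g)) / 2 ^ n \<le> 4 * (1 - collision n U g)"
    using conjugation_rounding[OF assms] by metis
  define V where "V = matsum ?N ?G (\<lambda>g. T g * U * adj g)"
  define a where "a g = Re (hs_inner (U * g * adj U) (T g)) / 2 ^ n" for g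
  let ?m = "real (card ?G)"
  note Uc [simp] = unitary_matD(1)[OF U]
  have Tc [simp]: "T g \<in> carrier_mat ?N ?N" if "g \<in> ?G" for g using T[OF that] by simp
  have Fc: "T g * U * adj g \<in> carrier_mat ?N ?N" if "g \<in> ?G" for g
    using that by (intro mult_square_carrier) auto
  have Vc: "V \<in> carrier_mat ?N ?N" by (simp add: V_def)
  have m: "?m > 0" using card_pauli_group_pos by simp
  have inter: "T h * V = V * h" if h: "h \<in> ?G" for h
  proof -
    have "T h * V = matsum ?N ?G (\<lambda>g. T h * (T g * U * adj g))"
      unfolding V_def using h Fc by (intro mult_matsum) auto
    also have "\<dots> = matsum ?N ?G (\<lambda>g. T (h * g) * U * adj (h * g) * h)"
    proof (rule matsum_cong)
      fix g assume g: "g \<in> ?G"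
      have "adj (h * g) * h = adj g"
        using g h unitary_matD(2)[OF pauli_group_unitary[OF h]]
        by (simp add: adj_mult[of _ ?N ?N _ ?N] assoc_mult_mat[of _ ?N ?N _ ?N _ ?N] right_mult_one_mat[of _ ?N ?N])
      moreover have "T (h * g) * U * adj (h * g) * h = T h * (T g * U) * (adj (h * g) * h)"
        using g h pauli_group_mult[OF h g] by (simp add: mult assoc_mult_mat[of _ ?N ?N _ ?N _ ?N])
      ultimately show "T h * (T g * U * adj g) = T (h * g) * U * adj (h * g) * h"
        using g h by (simp add: assoc_mult_mat[of _ ?N ?N _ ?N _ ?N])
    qed
    \<comment> \<open>Left translation by \<open>h\<close> permutes the group; multiplicativity of
      \<open>T\<close> was used to bring the summand into translated form.\<close>
    also have "\<dots> = matsum ?N ?G (\<lambda>g. T g * U * adj g * h)"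
      by (rule matsum_reindex[OF pauli_group_mult_bij[OF h], of _ "\<lambda>g. T g * U * adj g * h"])
    also have "\<dots> = V * h"
      unfolding V_def using h Fc by (intro matsum_mult[symmetric]) auto
    finally show ?thesis .
  qed
  have "hs_inner U V = (\<Sum>g\<in>?G. hs_inner (U * g * adj U) (T g))"
  proof -
    have "hs_inner U (T g * U * adj g) = hs_inner (U * g * adj U) (T g)" if "g \<in> ?G" for g
      using that hs_inner_mult_right[of "adj U" ?N "U * g" "T g"] hs_inner_mult_right[of g ?N U "T g * U"] by simp
    then show ?thesis by (simp add: V_def hs_inner_matsum_right)
  qed
  then have UV: "Re (hs_inner U V) = 2 ^ n * (\<Sum>g\<in>?G. a g)"
    by (simp add: a_def sum_distrib_left)
  \<comment> \<open>By the intertwining relation every summand of \<open>V\<close> has the same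
    inner product with \<open>V\<close> as \<open>U\<close> has. Only the right-hand
    \<open>V\<close> is expanded.\<close>
  have VV: "hs_inner V V = ?m * hs_inner V U"
  proof -
    have "hs_inner V (T g * U * adj g) = hs_inner V U" if g: "g \<in> ?G" for g
    proof -
      have "hs_inner V (T g * U * adj g) = hs_inner (V * g) (T g * U)"
        using g Vc by (simp add: hs_inner_mult_right[of _ ?N])
      also have "\<dots> = hs_inner V (adj (T g) * (T g * U))"
        using g Vc by (simp add: inter[symmetric] hs_inner_mult_left[of _ ?N])
      also have "\<dots> = hs_inner V U"
        using unitary_cancel_left(1)[OF pauli_group_unitary[OF T[OF g]] Uc] by simp
      finally show ?thesis .
    qed
    then show ?thesis by (subst (2) V_def) (simp add: hs_inner_matsum_right[OF Vc])
  qed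
  define lam where "lam = (\<Sum>g\<in>?G. a g) / ?m"
  have UVl: "Re (hs_inner U V) = 2 ^ n * (?m * lam)" using m by (simp add: UV lam_def)
  have "complex_of_real ((hs_norm V)\<^sup>2) = ?m * hs_inner V U" using VV by (simp add: hs_inner_self)
  then have "Re (complex_of_real ((hs_norm V)\<^sup>2)) = Re (?m * hs_inner V U)" by simp
  then have H: "(hs_norm V)\<^sup>2 = 2 ^ n * ?m\<^sup>2 * lam"
    using UVl hs_inner_commute[OF Uc Vc] by (simp add: power2_eq_square)
  have "a g \<le> 1" if "g \<in> ?G" for g
    using hs_norm_unitary_diff[OF conj_unitary[OF U pauli_group_unitary[OF that]] pauli_group_unitary[OF T[OF that]]]
      zero_le_power2[of "hs_norm (U * g * adj U - T g)"]
    unfolding a_def by simp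
  then have "(\<Sum>g\<in>?G. a g) \<le> (\<Sum>g\<in>?G. 1)" by (intro sum_mono)
  then have lam1: "lam \<le> 1" using m by (simp add: lam_def)
  have "(\<Sum>g\<in>?G. 1 - a g) \<le> (\<Sum>g\<in>?G. 4 * (1 - collision n U g))"
    unfolding a_def using close by (intro sum_mono)
  moreover have "1 - lam = (\<Sum>g\<in>?G. 1 - a g) / ?m"
    using pauli_group_one[of n] by (auto simp: lam_def sum_subtractf diff_divide_distrib)
  ultimately have lam_close: "1 - lam \<le> 4 * (\<Sum>g\<in>?G. 1 - collision n U g) / ?m"
    using m by (simp add: sum_distrib_left divide_right_mono)
  \<comment> \<open>Here 4/80 < 1 keeps \<open>lam\<close> positive, so that \<open>V\<close> is
    nonzero and can be normalised.\<close>
  moreover have "4 * (\<Sum>g\<in>?G. 1 - collision n U g) / ?m < 1"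
    using small m by (simp add: field_simps)
  ultimately have lam0: "lam > 0" by simp
  then have Hpos: "hs_norm V > 0"
    using H m hs_norm_nonneg[of V] by (cases "hs_norm V = 0") auto
  let ?r = "sqrt (2 ^ n) / hs_norm V"
  define W where "W = complex_of_real ?r \<cdot>\<^sub>m V"
  have WC: "W \<in> clifford_group n"
    unfolding W_def using clifford_of_intertwiner[OF Vc Hpos T inter] .
  then have Wu: "unitary_mat ?N W" by (simp add: clifford_group_def unitaries_def)
  have "(hs_norm V)\<^sup>2 \<le> 2 ^ n * ?m\<^sup>2 * 1" unfolding H using lam1 by (intro mult_left_mono) auto
  also have "\<dots> = (?m * sqrt (2 ^ n))\<^sup>2" by (simp add: power_mult_distrib)
  finally have "(hs_norm V)\<^sup>2 \<le> (?m * sqrt (2 ^ n))\<^sup>2" .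
  then have "hs_norm V \<le> ?m * sqrt (2 ^ n)" by (rule power2_le_imp_le) simp
  \<comment> \<open>The average of unitaries has norm at most that of a unitary, so scaling it to
    full norm multiplies it by at least 1.\<close>
  then have "1 \<le> ?r * ?m" using Hpos by (simp add: field_simps)
  then have "lam * 2 ^ n \<le> (?r * ?m) * (lam * 2 ^ n)" 
    using lam0 mult_right_mono[of 1 "?r * ?m" "lam * 2 ^ n"] by simp
  also have "\<dots> = Re (hs_inner U W)"
    unfolding W_def using UVl by (simp add: hs_inner_smult_right[OF Uc Vc] del: of_real_divide)
  also have "\<dots> \<le> cmod (hs_inner U W)" by (rule complex_Re_le_cmod)
  finally have "1 - cmod (hs_inner U W) / ?N \<le> 1 - lam" by (simp add: field_simps)
  moreover have "dist_phase U W \<le> sqrt (1 - cmod (hs_inner U W) / ?N)"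
    by (rule dist_phase_le[OF U Wu]) simp
  ultimately have "dist_phase U W \<le> sqrt (4 * (\<Sum>g\<in>?G. 1 - collision n U g) / ?m)"
    using lam_close by (meson order_trans real_sqrt_le_mono)
  then show ?thesis using WC by blast
qed

section \<open>Query algorithms\<close>

definition tens :: "complex vec \<Rightarrow> complex vec \<Rightarrow> complex vec" where
  "tens v w = vec (dim_vec v * dim_vec w) (\<lambda>i. v $ (i div dim_vec w) * w $ (i mod dim_vec w))"

lemma dim_tens [simp]: "dim_vec (tens v w) = dim_vec v * dim_vec w"
  by (simp add: tens_def)

lemma tens_carrier: "v \<in> carrier_vec a \<Longrightarrow> w \<in> carrier_vec b \<Longrightarrow> tens v w \<in> carrier_vec (a * b)"
  by (auto simp: tens_def)

lemma kron_mult_tens: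
  assumes A: "A \<in> carrier_mat a b" and B: "B \<in> carrier_mat c d"
    and v: "v \<in> carrier_vec b" and w: "w \<in> carrier_vec d"
  shows "kron A B *\<^sub>v tens v w = tens (A *\<^sub>v v) (B *\<^sub>v w)"
proof (rule eq_vecI)
  fix i assume "i < dim_vec (tens (A *\<^sub>v v) (B *\<^sub>v w))"
  then have i: "i < a * c" using A B by simp
  note dm = div_mod_less[OF i]
  let ?f = "\<lambda>k l. A $$ (i div c, k) * B $$ (i mod c, l) * (v $ k * w $ l)"
  have "(kron A B *\<^sub>v tens v w) $ i = (\<Sum>k<b*d. ?f (k div d) (k mod d))"
    using assms i by (simp add: scalar_prod_def atLeast0LessThan index_kron[OF A B] tens_def)
  also have "\<dots> = (\<Sum>k<b. \<Sum>l<d. ?f k l)" by (rule sum_div_mod)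
  also have "\<dots> = (\<Sum>k<b. A $$ (i div c, k) * v $ k) * (\<Sum>l<d. B $$ (i mod c, l) * w $ l)"
    by (simp add: sum_product mult_ac)
  also have "\<dots> = tens (A *\<^sub>v v) (B *\<^sub>v w) $ i"
    using assms i dm by (simp add: tens_def scalar_prod_def atLeast0LessThan)
  finally show "(kron A B *\<^sub>v tens v w) $ i = tens (A *\<^sub>v v) (B *\<^sub>v w) $ i" .
qed (use assms in auto)

definition vinner :: "complex vec \<Rightarrow> complex vec \<Rightarrow> complex" where
  "vinner v w = (\<Sum>i<dim_vec v. cnj (v $ i) * w $ i)"

lemma vinner_self: "vinner v v = of_real (vnorm2 v)"
  unfolding vinner_def vnorm2_def by (simp only: of_real_sum complex_norm_square mult.commute)

lemma vinner_tens:
  assumes "v \<in> carrier_vec a" "v' \<in> carrier_vec a" "w \<in> carrier_vec b" "w' \<in> carrier_vec b"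
  shows "vinner (tens v w) (tens v' w') = vinner v v' * vinner w w'"
proof -
  let ?f = "\<lambda>i j. cnj (v $ i) * cnj (w $ j) * (v' $ i * w' $ j)"
  have "vinner (tens v w) (tens v' w') = (\<Sum>i<a*b. ?f (i div b) (i mod b))"
    using assms by (simp add: vinner_def tens_def)
  also have "\<dots> = (\<Sum>i<a. \<Sum>j<b. ?f i j)" by (rule sum_div_mod)
  finally show ?thesis using assms by (simp add: vinner_def sum_product mult_ac)
qed

lemma vnorm2_tens: "vnorm2 (tens v w) = vnorm2 v * vnorm2 w"
proof -
  have "vinner (tens v w) (tens v w) = vinner v v * vinner w w"
    by (rule vinner_tens) (rule carrier_vec_dim_vec)+
  then show ?thesis by (simp only: vinner_self of_real_mult[symmetric] of_real_eq_iff)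
qed

text \<open>Queries act on the leading tensor factor only, so a fresh copy must be exchanged into
  that position before its preparation starts.\<close>

definition swap_mat :: "nat \<Rightarrow> nat \<Rightarrow> complex mat" where
  "swap_mat a b = mat (b * a) (a * b) (\<lambda>(i,j). if i div a = j mod b \<and> i mod a = j div b then 1 else 0)"

lemma swap_mat_tens:
  assumes "v \<in> carrier_vec a" "w \<in> carrier_vec b"
  shows "swap_mat a b *\<^sub>v tens v w = tens w v"
proof (rule eq_vecI)
  fix i assume "i < dim_vec (tens w v)"
  then have i: "i < b * a" using assms by simp
  note dm = div_mod_less[OF i]
  let ?f = "\<lambda>k l. (if l = i div a then (if k = i mod a then v $ k * w $ l else 0) else 0)"
  have "(swap_mat a b *\<^sub>v tens v w) $ i = (\<Sum>k<a*b. ?f (k div b) (k mod b))"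
    using assms i by (auto simp: scalar_prod_def atLeast0LessThan swap_mat_def tens_def intro!: sum.cong)
  also have "\<dots> = (\<Sum>k<a. \<Sum>l<b. ?f k l)" by (rule sum_div_mod)
  also have "\<dots> = v $ (i mod a) * w $ (i div a)" using dm by simp
  also have "\<dots> = tens w v $ i" using assms i by (simp add: tens_def)
  finally show "(swap_mat a b *\<^sub>v tens v w) $ i = tens w v $ i" .
qed (use assms in \<open>auto simp: swap_mat_def\<close>)

lemma swap_mat_mult: "swap_mat b a * swap_mat a b = 1\<^sub>m (a * b)"
proof (rule eq_matI)
  fix i j assume "i < dim_row (1\<^sub>m (a * b) :: complex mat)" "j < dim_col (1\<^sub>m (a * b) :: complex mat)"
  then have ij: "i < a * b" "j < a * b" by auto
  note dm = div_mod_less[OF ij(1)] div_mod_less[OF ij(2)]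
  let ?f = "\<lambda>k l. (if l = i div b then (if k = i mod b then (if k = j mod b \<and> l = j div b then 1 else 0) else 0) else 0) :: complex"
  have "(swap_mat b a * swap_mat a b) $$ (i,j) = (\<Sum>k<b*a. ?f (k div a) (k mod a))"
    using ij by (auto simp: scalar_prod_def atLeast0LessThan swap_mat_def intro!: sum.cong)
  also have "\<dots> = (\<Sum>k<b. \<Sum>l<a. ?f k l)" by (rule sum_div_mod)
  also have "\<dots> = (if i = j then 1 else 0)" using dm div_mod_eq_iff[of i b j] by auto
  finally show "(swap_mat b a * swap_mat a b) $$ (i,j) = 1\<^sub>m (a * b) $$ (i,j)" using ij by simp
qed (auto simp: swap_mat_def)

lemma adj_swap_mat: "adj (swap_mat a b) = swap_mat b a"
  by (rule eq_matI) (auto simp: swap_mat_def)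

lemma swap_mat_unitary: "unitary_mat (a * b) (swap_mat a b)"
  using swap_mat_mult[of b a] swap_mat_mult[of a b]
  by (simp add: unitary_mat_def adj_swap_mat mult.commute[of b a]) (simp add: swap_mat_def mult.commute)

section \<open>Control by a classical register\<close>

text \<open>The controlled operation that applies \<open>F k\<close> when the last register, of
  dimension \<open>K\<close>, holds \<open>k\<close>.\<close>

definition ctrl :: "nat \<Rightarrow> nat \<Rightarrow> (nat \<Rightarrow> complex mat) \<Rightarrow> complex mat" where
  "ctrl K D F = mat (D * K) (D * K)
     (\<lambda>(i,j). if i mod K = j mod K then F (i mod K) $$ (i div K, j div K) else 0)"

text \<open>Uniform superposition over the control register. It replaces a random choice of
  \<open>k\<close>, since the algorithm model starts from a pure state and applies unitaries;
  \<open>vnorm2_stack\<close> turns it back into an average.\<close>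

definition stack :: "nat \<Rightarrow> nat \<Rightarrow> (nat \<Rightarrow> complex vec) \<Rightarrow> complex vec" where
  "stack K D \<phi> = vec (D * K) (\<lambda>i. \<phi> (i mod K) $ (i div K) / of_real (sqrt K))"

lemma ctrl_carrier [simp]: "ctrl K D F \<in> carrier_mat (D * K) (D * K)"
  by (simp add: ctrl_def)

lemma stack_carrier [simp]: "stack K D \<phi> \<in> carrier_vec (D * K)"
  by (simp add: stack_def)

lemma ctrl_mult:
  assumes "\<And>k. k < K \<Longrightarrow> F k \<in> carrier_mat D D" "\<And>k. k < K \<Longrightarrow> G k \<in> carrier_mat D D"
  shows "ctrl K D F * ctrl K D G = ctrl K D (\<lambda>k. F k * G k)"
proof (rule eq_matI)
  fix i j assume "i < dim_row (ctrl K D (\<lambda>k. F k * G k))" "j < dim_col (ctrl K D (\<lambda>k. F k * G k))"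
  then have ij: "i < D * K" "j < D * K" by (auto simp: ctrl_def)
  note dm = div_mod_less[OF ij(1)] div_mod_less[OF ij(2)]
  note FG = assms(1)[OF dm(2)] assms(2)[OF dm(2)]
  let ?f = "\<lambda>a b. (if b = i mod K then (if i mod K = j mod K then F (i mod K) $$ (i div K, a) * G (i mod K) $$ (a, j div K) else 0) else 0)"
  have "(ctrl K D F * ctrl K D G) $$ (i,j) = (\<Sum>k<D*K. ?f (k div K) (k mod K))"
    using ij by (auto simp: scalar_prod_def atLeast0LessThan ctrl_def intro!: sum.cong)
  also have "\<dots> = (\<Sum>a<D. \<Sum>b<K. ?f a b)" by (rule sum_div_mod)
  also have "\<dots> = ctrl K D (\<lambda>k. F k * G k) $$ (i,j)"
    using ij dm FG by (cases "i mod K = j mod K") (simp_all add: ctrl_def scalar_prod_def atLeast0LessThan)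
  finally show "(ctrl K D F * ctrl K D G) $$ (i,j) = ctrl K D (\<lambda>k. F k * G k) $$ (i,j)" .
qed (auto simp: ctrl_def)

lemma ctrl_cong: "(\<And>k. k < K \<Longrightarrow> F k = G k) \<Longrightarrow> ctrl K D F = ctrl K D G"
  by (rule eq_matI) (auto simp: ctrl_def dest: div_mod_less(2))

lemma adj_ctrl:
  assumes "\<And>k. k < K \<Longrightarrow> F k \<in> carrier_mat D D"
  shows "adj (ctrl K D F) = ctrl K D (\<lambda>k. adj (F k))"
proof (rule eq_matI)
  fix i j assume "i < dim_row (ctrl K D (\<lambda>k. adj (F k)))" "j < dim_col (ctrl K D (\<lambda>k. adj (F k)))"
  then have ij: "i < D * K" "j < D * K" by (auto simp: ctrl_def)
  note dm = div_mod_less[OF ij(1)] div_mod_less[OF ij(2)]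
  show "adj (ctrl K D F) $$ (i,j) = ctrl K D (\<lambda>k. adj (F k)) $$ (i,j)"
    using ij dm assms[OF dm(2)] by (auto simp: ctrl_def)
qed (auto simp: ctrl_def)

lemma ctrl_one: "ctrl K D (\<lambda>_. 1\<^sub>m D) = 1\<^sub>m (D * K)"
proof (rule eq_matI)
  fix i j assume "i < dim_row (1\<^sub>m (D * K) :: complex mat)" "j < dim_col (1\<^sub>m (D * K) :: complex mat)"
  then have ij: "i < D * K" "j < D * K" by auto
  then show "ctrl K D (\<lambda>_. 1\<^sub>m D) $$ (i,j) = 1\<^sub>m (D * K) $$ (i,j)"
    using div_mod_less[OF ij(1)] div_mod_less[OF ij(2)] div_mod_eq_iff[of i K j] by (auto simp: ctrl_def)
qed (auto simp: ctrl_def)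

lemma ctrl_unitary:
  assumes "\<And>k. k < K \<Longrightarrow> unitary_mat D (F k)" shows "unitary_mat (D * K) (ctrl K D F)"
proof -
  note c = unitary_matD(1)[OF assms]
  have "ctrl K D (\<lambda>k. adj (F k) * F k) = 1\<^sub>m (D * K)" "ctrl K D (\<lambda>k. F k * adj (F k)) = 1\<^sub>m (D * K)"
    unfolding ctrl_one[symmetric] using unitary_matD[OF assms] by (auto intro!: ctrl_cong)
  then show ?thesis using c by (simp add: unitary_mat_def adj_ctrl ctrl_mult)
qed

lemma ctrl_mult_stack:
  assumes "\<And>k. k < K \<Longrightarrow> F k \<in> carrier_mat D D" "\<And>k. k < K \<Longrightarrow> \<phi> k \<in> carrier_vec D"
  shows "ctrl K D F *\<^sub>v stack K D \<phi> = stack K D (\<lambda>k. F k *\<^sub>v \<phi> k)"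
proof (rule eq_vecI)
  fix i assume "i < dim_vec (stack K D (\<lambda>k. F k *\<^sub>v \<phi> k))"
  then have i: "i < D * K" by (simp add: stack_def)
  note dm = div_mod_less[OF i]
  let ?f = "\<lambda>a b. (if b = i mod K then F (i mod K) $$ (i div K, a) * \<phi> (i mod K) $ a / of_real (sqrt K) else 0)"
  have "(ctrl K D F *\<^sub>v stack K D \<phi>) $ i = (\<Sum>k<D*K. ?f (k div K) (k mod K))"
    using i by (auto simp: scalar_prod_def atLeast0LessThan ctrl_def stack_def intro!: sum.cong)
  also have "\<dots> = (\<Sum>a<D. \<Sum>b<K. ?f a b)" by (rule sum_div_mod)
  also have "\<dots> = stack K D (\<lambda>k. F k *\<^sub>v \<phi> k) $ i"
    using i dm assms[OF dm(2)] by (simp add: stack_def scalar_prod_def atLeast0LessThan sum_divide_distrib)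
  finally show "(ctrl K D F *\<^sub>v stack K D \<phi>) $ i = stack K D (\<lambda>k. F k *\<^sub>v \<phi> k) $ i" .
qed (auto simp: ctrl_def stack_def)

lemma stack_cong: "(\<And>k. k < K \<Longrightarrow> \<phi> k = \<chi> k) \<Longrightarrow> stack K D \<phi> = stack K D \<chi>"
  by (rule eq_vecI) (auto simp: stack_def dest: div_mod_less(2))

lemma vnorm2_stack:
  assumes "\<And>k. k < K \<Longrightarrow> \<phi> k \<in> carrier_vec D"
  shows "vnorm2 (stack K D \<phi>) = (\<Sum>k<K. vnorm2 (\<phi> k)) / K"
proof -
  have "vnorm2 (stack K D \<phi>) = (\<Sum>i<D*K. (\<lambda>a b. (cmod (\<phi> b $ a))\<^sup>2 / K) (i div K) (i mod K))"
    by (simp add: vnorm2_def stack_def norm_divide power_divide)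
  also have "\<dots> = (\<Sum>a<D. \<Sum>b<K. (cmod (\<phi> b $ a))\<^sup>2 / K)" by (rule sum_div_mod)
  also have "\<dots> = (\<Sum>b<K. \<Sum>a<D. (cmod (\<phi> b $ a))\<^sup>2 / K)" by (rule sum.swap)
  also have "\<dots> = (\<Sum>k<K. vnorm2 (\<phi> k)) / K"
    using assms[THEN carrier_vecD] by (simp add: vnorm2_def sum_divide_distrib)
  finally show ?thesis .
qed

lemma kron_one_ctrl:
  assumes "V \<in> carrier_mat D D" shows "kron V (1\<^sub>m K) = ctrl K D (\<lambda>_. V)"
proof (rule eq_matI)
  fix i j assume "i < dim_row (ctrl K D (\<lambda>_. V))" "j < dim_col (ctrl K D (\<lambda>_. V))"
  then have ij: "i < D * K" "j < D * K" by (auto simp: ctrl_def)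
  then show "kron V (1\<^sub>m K) $$ (i,j) = ctrl K D (\<lambda>_. V) $$ (i,j)"
    using div_mod_less[OF ij(1)] div_mod_less[OF ij(2)] assms by (auto simp: ctrl_def kron_def)
qed (use assms in \<open>auto simp: ctrl_def\<close>)

text \<open>Allows an ancilla to be enlarged: a query with ancilla dimension \<open>M * K\<close> is
  a query with ancilla dimension \<open>M\<close>, extended by the identity.\<close>

lemma kron_one_assoc: "kron U (1\<^sub>m (M * K)) = kron (kron U (1\<^sub>m M)) (1\<^sub>m K)"
proof (rule eq_matI)
  fix i j assume "i < dim_row (kron (kron U (1\<^sub>m M)) (1\<^sub>m K))" "j < dim_col (kron (kron U (1\<^sub>m M)) (1\<^sub>m K))"
  then have b: "i < dim_row U * M * K" "j < dim_col U * M * K" by auto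
  then have b': "i < dim_row U * (M * K)" "j < dim_col U * (M * K)" by (simp_all add: mult.assoc)
  note dm = div_mod_less[OF b(1)] div_mod_less[OF b(2)] div_mod_less[OF b'(1)] div_mod_less[OF b'(2)]
  note dm' = div_mod_less[OF dm(1)] div_mod_less[OF dm(3)]
  have d: "x div (M * K) = x div K div M" for x
    by (simp add: mult.commute[of M K] div_mult2_eq)
  have K: "K > 0" using b by (cases K) auto
  \<comment> \<open>Mixed-radix expansion: the remainder consists of a digit in base
    \<open>M\<close> above a digit in base \<open>K\<close>, so two remainders agree exactly when
    both digits do.\<close>
  have *: "z mod (M * K) = K * (z div K mod M) + z mod K" for z
    by (simp add: mult.commute[of M K] mod_mult2_eq)
  have "(z mod (M * K)) div K = z div K mod M" "(z mod (M * K)) mod K = z mod K" for z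
    unfolding * using K by simp_all
  then have m: "i mod (M * K) = j mod (M * K) \<longleftrightarrow> i div K mod M = j div K mod M \<and> i mod K = j mod K"
    using *[of i] *[of j] by metis
  have "kron U (1\<^sub>m (M * K)) $$ (i,j) =
      U $$ (i div (M * K), j div (M * K)) * (if i mod (M * K) = j mod (M * K) then 1 else 0)"
    using b' dm by (simp add: kron_def)
  also have "\<dots> = U $$ (i div K div M, j div K div M) * (if i div K mod M = j div K mod M then 1 else 0) *
      (if i mod K = j mod K then 1 else 0)"
    unfolding d m by simp
  also have "\<dots> = kron (kron U (1\<^sub>m M)) (1\<^sub>m K) $$ (i,j)"
    using b dm dm' by (simp add: kron_def)
  finally show "kron U (1\<^sub>m (M * K)) $$ (i,j) = kron (kron U (1\<^sub>m M)) (1\<^sub>m K) $$ (i,j)" .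
qed (simp_all add: mult.assoc)

lemma kron_one_unitary: "unitary_mat D V \<Longrightarrow> unitary_mat (D * K) (kron V (1\<^sub>m K))"
  using ctrl_unitary[of K D "\<lambda>_. V"] kron_one_ctrl[OF unitary_matD(1)] by metis

text \<open>\<open>prep N M K q \<phi>\<close>: for every \<open>k < K\<close> the state \<open>\<phi> k U\<close> is prepared from a state not depending
  on \<open>U\<close> with an \<open>M\<close>-dimensional ancilla by \<open>q\<close> queries, whose types do not depend on \<open>k\<close>.\<close>

inductive prep :: "nat \<Rightarrow> nat \<Rightarrow> nat \<Rightarrow> nat \<Rightarrow> (nat \<Rightarrow> complex mat \<Rightarrow> complex vec) \<Rightarrow> bool" for N M K where
  init: "prep N M K 0 \<phi>" if
    "\<And>k. k < K \<Longrightarrow> v k \<in> carrier_vec (N * M)" "\<And>k. k < K \<Longrightarrow> vnorm2 (v k) = 1"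
    "\<And>k U. k < K \<Longrightarrow> U \<in> unitaries N \<Longrightarrow> \<phi> k U = v k"
| op: "prep N M K q \<phi>'" if "prep N M K q \<phi>"
    "\<And>k. k < K \<Longrightarrow> unitary_mat (N * M) (V k)"
    "\<And>k U. k < K \<Longrightarrow> U \<in> unitaries N \<Longrightarrow> \<phi>' k U = V k *\<^sub>v \<phi> k U"
| query: "prep N M K (Suc q) \<phi>'" if "prep N M K q \<phi>"
    "\<And>k U. k < K \<Longrightarrow> U \<in> unitaries N \<Longrightarrow> \<phi>' k U = query_op U M b *\<^sub>v \<phi> k U"

lemma query_op_carrier:
  "U \<in> unitaries N \<Longrightarrow> query_op U M b \<in> carrier_mat (N * M) (N * M)"
  by (auto simp: query_op_def unitaries_def unitary_mat_def intro!: kron_carrier)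

lemma query_op_mult: "query_op U (M * K) b = kron (query_op U M b) (1\<^sub>m K)"
  by (simp add: query_op_def kron_one_assoc)

lemma prep_carrier:
  "prep N M K q \<phi> \<Longrightarrow> k < K \<Longrightarrow> U \<in> unitaries N \<Longrightarrow> \<phi> k U \<in> carrier_vec (N * M)"
proof (induction rule: prep.induct)
  case (op q \<phi> V \<phi>')
  then show ?case using unitary_matD(1)[OF op.hyps(2)[OF op.prems(1)]] by simp
next
  case (query q \<phi> \<phi>' b)
  then show ?case using query_op_carrier[of U N M b] by simp
qed simp

lemma prep_tens_const:
  assumes "prep N M K q \<phi>"
    and w: "\<And>k. k < K \<Longrightarrow> w k \<in> carrier_vec D" "\<And>k. k < K \<Longrightarrow> vnorm2 (w k) = 1"
  shows "prep N (M * D) K q (\<lambda>k U. tens (\<phi> k U) (w k))"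
  using assms(1)
proof (induction rule: prep.induct)
  case (init v \<phi>)
  show ?case
    by (rule prep.init[where v = "\<lambda>k. tens (v k) (w k)"])
      (use init w in \<open>auto simp: vnorm2_tens mult.assoc[symmetric] intro!: tens_carrier\<close>)
next
  case (op q \<phi> V \<phi>')
  show ?case
  proof (rule prep.op[OF op.IH, where V = "\<lambda>k. kron (V k) (1\<^sub>m D)"])
    fix k assume k: "k < K"
    show "unitary_mat (N * (M * D)) (kron (V k) (1\<^sub>m D))"
      using kron_one_unitary[OF op.hyps(2)[OF k]] by (simp add: mult.assoc)
    fix U assume U: "U \<in> unitaries N"
    show "tens (\<phi>' k U) (w k) = kron (V k) (1\<^sub>m D) *\<^sub>v tens (\<phi> k U) (w k)"
      using kron_mult_tens[OF unitary_matD(1)[OF op.hyps(2)[OF k]] one_carrier_mat prep_carrier[OF op.hyps(1) k U] w(1)[OF k]]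
        op.hyps(3)[OF k U] w(1)[OF k] by simp
  qed
next
  case (query q \<phi> \<phi>' b)
  show ?case
  proof (rule prep.query[OF query.IH, where b = b])
    fix k U assume k: "k < K" and U: "U \<in> unitaries N"
    show "tens (\<phi>' k U) (w k) = query_op U (M * D) b *\<^sub>v tens (\<phi> k U) (w k)"
      using kron_mult_tens[OF query_op_carrier[OF U] one_carrier_mat prep_carrier[OF query.hyps(1) k U] w(1)[OF k]]
        query.hyps(2)[OF k U] w(1)[OF k] by (simp add: query_op_mult)
  qed
qed

text \<open>The two preparations run one after the other. The base case prepares all of
  \<open>\<phi>\<close> beside the idle initial state of \<open>\<chi>\<close> and then swaps, so
  that the system register of \<open>\<chi>\<close> comes first; the induction then performs the
  steps of \<open>\<chi>\<close> with \<open>\<phi>\<close> as extra ancilla.\<close>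

lemma prep_tens:
  assumes "prep N M' K q' \<chi>" and \<phi>: "prep N M K q \<phi>"
  shows "prep N (M' * (N * M)) K (q + q') (\<lambda>k U. tens (\<chi> k U) (\<phi> k U))"
  using assms(1)
proof (induction rule: prep.induct)
  case (init v \<chi>)
  have *: "prep N (M * (N * M')) K q (\<lambda>k U. tens (\<phi> k U) (v k))"
    using prep_tens_const[OF \<phi>, of v "N * M'"] init by blast
  have dim: "M * (N * M') = M' * (N * M)" "N * M * (N * M') = N * (M' * (N * M))" by simp_all
  have "prep N (M' * (N * M)) K q (\<lambda>k U. tens (\<chi> k U) (\<phi> k U))"
  proof (rule prep.op[OF *[unfolded dim(1)], where V = "\<lambda>_. swap_mat (N * M) (N * M')"])
    show "unitary_mat (N * (M' * (N * M))) (swap_mat (N * M) (N * M'))"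
      using swap_mat_unitary[of "N * M" "N * M'"] unfolding dim(2) .
    fix k U assume k: "k < K" and U: "U \<in> unitaries N"
    show "tens (\<chi> k U) (\<phi> k U) = swap_mat (N * M) (N * M') *\<^sub>v tens (\<phi> k U) (v k)"
      using swap_mat_tens[OF prep_carrier[OF \<phi> k U] init(1)[OF k]] init(3)[OF k U] by simp
  qed
  then show ?case by simp
next
  case (op q' \<chi> V \<chi>')
  show ?case
  proof (rule prep.op[OF op.IH, where V = "\<lambda>k. kron (V k) (1\<^sub>m (N * M))"])
    fix k assume k: "k < K"
    show "unitary_mat (N * (M' * (N * M))) (kron (V k) (1\<^sub>m (N * M)))"
      using kron_one_unitary[OF op.hyps(2)[OF k], of "N * M"] by (simp only: mult.assoc)
    fix U assume U: "U \<in> unitaries N"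
    show "tens (\<chi>' k U) (\<phi> k U) = kron (V k) (1\<^sub>m (N * M)) *\<^sub>v tens (\<chi> k U) (\<phi> k U)"
      using kron_mult_tens[OF unitary_matD(1)[OF op.hyps(2)[OF k]] one_carrier_mat prep_carrier[OF op.hyps(1) k U] prep_carrier[OF \<phi> k U]]
        op.hyps(3)[OF k U] prep_carrier[OF \<phi> k U] by simp
  qed
next
  case (query q' \<chi> \<chi>' b)
  have "prep N (M' * (N * M)) K (Suc (q + q')) (\<lambda>k U. tens (\<chi>' k U) (\<phi> k U))"
  proof (rule prep.query[OF query.IH, where b = b])
    fix k U assume k: "k < K" and U: "U \<in> unitaries N"
    show "tens (\<chi>' k U) (\<phi> k U) = query_op U (M' * (N * M)) b *\<^sub>v tens (\<chi> k U) (\<phi> k U)"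
      using kron_mult_tens[OF query_op_carrier[OF U] one_carrier_mat prep_carrier[OF query.hyps(1) k U] prep_carrier[OF \<phi> k U]]
        query.hyps(2)[OF k U] prep_carrier[OF \<phi> k U] by (simp add: query_op_mult)
  qed
  then show ?case by simp
qed

text \<open>Fixed operations become controlled ones, whereas a query acts identically on every block
  and stays a single query. This works because the query types are shared by all
  \<open>k\<close>.\<close>

lemma prep_stack:
  assumes "prep N M K q \<phi>" and K: "K > 0"
  shows "prep N (M * K) 1 q (\<lambda>_ U. stack K (N * M) (\<lambda>k. \<phi> k U))"
  using assms(1)
proof (induction rule: prep.induct)
  case (init v \<phi>)
  show ?case
  proof (rule prep.init[where v = "\<lambda>_. stack K (N * M) v"])
    show "stack K (N * M) v \<in> carrier_vec (N * (M * K))"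
      using stack_carrier[of K "N * M" v] by (simp only: mult.assoc)
    show "vnorm2 (stack K (N * M) v) = 1"
      using init K by (simp add: vnorm2_stack)
    show "stack K (N * M) (\<lambda>k. \<phi> k U) = stack K (N * M) v" if "U \<in> unitaries N" for U
      using init that by (intro stack_cong) auto
  qed
next
  case (op q \<phi> V \<phi>')
  show ?case
  proof (rule prep.op[OF op.IH, where V = "\<lambda>_. ctrl K (N * M) V"])
    show "unitary_mat (N * (M * K)) (ctrl K (N * M) V)"
      using ctrl_unitary[of K "N * M" V] op.hyps(2) by (simp only: mult.assoc)
    fix U assume U: "U \<in> unitaries N"
    have "ctrl K (N * M) V *\<^sub>v stack K (N * M) (\<lambda>k. \<phi> k U) = stack K (N * M) (\<lambda>k. V k *\<^sub>v \<phi> k U)"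
      using unitary_matD(1)[OF op.hyps(2)] prep_carrier[OF op.hyps(1) _ U] by (rule ctrl_mult_stack)
    also have "\<dots> = stack K (N * M) (\<lambda>k. \<phi>' k U)" using op.hyps(3) U by (intro stack_cong) auto
    finally show "stack K (N * M) (\<lambda>k. \<phi>' k U) = ctrl K (N * M) V *\<^sub>v stack K (N * M) (\<lambda>k. \<phi> k U)" ..
  qed
next
  case (query q \<phi> \<phi>' b)
  show ?case
  proof (rule prep.query[OF query.IH, where b = b])
    fix U assume U: "U \<in> unitaries N"
    have "query_op U (M * K) b *\<^sub>v stack K (N * M) (\<lambda>k. \<phi> k U)
        = ctrl K (N * M) (\<lambda>_. query_op U M b) *\<^sub>v stack K (N * M) (\<lambda>k. \<phi> k U)"
      by (simp only: query_op_mult kron_one_ctrl[OF query_op_carrier[OF U]])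
    also have "\<dots> = stack K (N * M) (\<lambda>k. query_op U M b *\<^sub>v \<phi> k U)"
      using query_op_carrier[OF U] prep_carrier[OF query.hyps(1) _ U] by (rule ctrl_mult_stack)
    also have "\<dots> = stack K (N * M) (\<lambda>k. \<phi>' k U)" using query.hyps(2) U by (intro stack_cong) auto
    finally show "stack K (N * M) (\<lambda>k. \<phi>' k U) = query_op U (M * K) b *\<^sub>v stack K (N * M) (\<lambda>k. \<phi> k U)" ..
  qed
qed

text \<open>Brings a preparation into the strictly alternating form of \<open>query_alg\<close>: a
  fixed operation is absorbed into the last unitary, or into \<open>V0\<close> before the first
  query, and each query is followed by an identity.\<close>

lemma prep_circuit:
  assumes "prep N M K q \<phi>" "k < K"
  shows "\<exists>\<psi> V0 Vs ts. \<psi> \<in> carrier_vec (N * M) \<and> vnorm2 \<psi> = 1 \<and> length Vs = length ts \<and> length ts = q \<and>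
    unitary_mat (N * M) V0 \<and> (\<forall>V\<in>set Vs. unitary_mat (N * M) V) \<and>
    (\<forall>U\<in>unitaries N. foldl (\<lambda>v (b, V). V *\<^sub>v (query_op U M b *\<^sub>v v)) (V0 *\<^sub>v \<psi>) (zip ts Vs) = \<phi> k U)"
  using assms(1)
proof (induction rule: prep.induct)
  case (init v \<phi>)
  then show ?case using assms(2)
    by (intro exI[of _ "v k"] exI[of _ "1\<^sub>m (N * M)"] exI[of _ "[]"]) auto
next
  case (op q \<phi> V \<phi>')
  then obtain \<psi> V0 Vs ts where h: "\<psi> \<in> carrier_vec (N * M)" "vnorm2 \<psi> = 1" "length Vs = length ts" "length ts = q"
    "unitary_mat (N * M) V0" "\<forall>V\<in>set Vs. unitary_mat (N * M) V"
    "\<forall>U\<in>unitaries N. foldl (\<lambda>v (b, V). V *\<^sub>v (query_op U M b *\<^sub>v v)) (V0 *\<^sub>v \<psi>) (zip ts Vs) = \<phi> k U"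
    by blast
  have V: "unitary_mat (N * M) (V k)" using op.hyps(2)[OF assms(2)] .
  show ?case
  proof (cases Vs rule: rev_cases)
    case Nil
    have "\<phi>' k U = (V k * V0) *\<^sub>v \<psi>" if U: "U \<in> unitaries N" for U
      using h(7) U Nil op.hyps(3)[OF assms(2) U] h(1)
        assoc_mult_mat_vec[OF unitary_matD(1)[OF V] unitary_matD(1)[OF h(5)] h(1)] by simp
    then show ?thesis using h Nil unitary_mat_mult[OF V h(5)]
      by (intro exI[of _ \<psi>] exI[of _ "V k * V0"] exI[of _ "[]"]) auto
  next
    case (snoc Vs' L)
    then obtain ts' b where ts: "ts = ts' @ [b]" "length ts' = length Vs'"
      using h(3) by (cases ts rule: rev_cases) auto
    have L: "unitary_mat (N * M) L" using h(6) snoc by simp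
    have "foldl (\<lambda>v (b, V). V *\<^sub>v (query_op U M b *\<^sub>v v)) (V0 *\<^sub>v \<psi>) (zip ts (Vs' @ [V k * L])) = \<phi>' k U"
      if U: "U \<in> unitaries N" for U
    proof -
      define x where "x = foldl (\<lambda>v (b, V). V *\<^sub>v (query_op U M b *\<^sub>v v)) (V0 *\<^sub>v \<psi>) (zip ts' Vs')"
      have x: "L *\<^sub>v (query_op U M b *\<^sub>v x) = \<phi> k U"
      proof -
        have "zip ts Vs = zip ts' Vs' @ [(b, L)]" using ts by (simp add: snoc)
        then show ?thesis using h(7)[rule_format, OF U] by (simp add: x_def)
      qed
      have q: "query_op U M b *\<^sub>v x \<in> carrier_vec (N * M)"
        by (rule carrier_vecI) (simp add: carrier_matD(1)[OF query_op_carrier[OF U]])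
      have "(V k * L) *\<^sub>v (query_op U M b *\<^sub>v x) = \<phi>' k U"
        using assoc_mult_mat_vec[OF unitary_matD(1)[OF V] unitary_matD(1)[OF L] q] x op.hyps(3)[OF assms(2) U] by simp
      then show ?thesis using ts by (simp add: x_def)
    qed
    then show ?thesis using h snoc unitary_mat_mult[OF V L]
      by (intro exI[of _ \<psi>] exI[of _ V0] exI[of _ "Vs' @ [V k * L]"] exI[of _ ts]) auto
  qed
next
  case (query q \<phi> \<phi>' b)
  then obtain \<psi> V0 Vs ts where h: "\<psi> \<in> carrier_vec (N * M)" "vnorm2 \<psi> = 1" "length Vs = length ts" "length ts = q"
    "unitary_mat (N * M) V0" "\<forall>V\<in>set Vs. unitary_mat (N * M) V"
    "\<forall>U\<in>unitaries N. foldl (\<lambda>v (b, V). V *\<^sub>v (query_op U M b *\<^sub>v v)) (V0 *\<^sub>v \<psi>) (zip ts Vs) = \<phi> k U"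
    by blast
  have "1\<^sub>m (N * M) *\<^sub>v (query_op U M b *\<^sub>v \<phi> k U) = \<phi>' k U" if U: "U \<in> unitaries N" for U
  proof -
    have "query_op U M b *\<^sub>v \<phi> k U \<in> carrier_vec (N * M)"
      by (rule carrier_vecI) (simp add: carrier_matD(1)[OF query_op_carrier[OF U]])
    then show ?thesis using query.hyps(2)[OF assms(2) U] by simp
  qed
  then show ?case using h
    by (intro exI[of _ \<psi>] exI[of _ V0] exI[of _ "Vs @ [1\<^sub>m (N * M)]"] exI[of _ "ts @ [b]"]) auto
qed

section \<open>Acceptance probabilities realised by query algorithms\<close>

definition projector :: "nat \<Rightarrow> complex mat \<Rightarrow> bool" where
  "projector D P \<longleftrightarrow> P \<in> carrier_mat D D \<and> adj P = P \<and> P * P = P"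

definition testable :: "nat \<Rightarrow> nat \<Rightarrow> (complex mat \<Rightarrow> real) \<Rightarrow> bool" where
  "testable N q p \<longleftrightarrow> (\<exists>M \<phi> P. M > 0 \<and> prep N M 1 q \<phi> \<and> projector (N * M) P \<and>
     (\<forall>U\<in>unitaries N. p U = vnorm2 (P *\<^sub>v \<phi> 0 U)))"

lemma testable_alg:
  assumes "testable N q p"
  shows "\<exists>A. valid_alg N A \<and> num_queries A = q \<and> (\<forall>U\<in>unitaries N. accept_prob A U = p U)"
proof -
  obtain M \<phi> P where M: "M > 0" and pr: "prep N M 1 q \<phi>" and P: "projector (N * M) P"
    and p: "\<forall>U\<in>unitaries N. p U = vnorm2 (P *\<^sub>v \<phi> 0 U)"
    using assms unfolding testable_def by blast
  obtain \<psi> V0 Vs ts where h: "\<psi> \<in> carrier_vec (N * M)" "vnorm2 \<psi> = 1" "length Vs = length ts" "length ts = q"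
    "unitary_mat (N * M) V0" "\<forall>V\<in>set Vs. unitary_mat (N * M) V"
    "\<forall>U\<in>unitaries N. foldl (\<lambda>v (b, V). V *\<^sub>v (query_op U M b *\<^sub>v v)) (V0 *\<^sub>v \<psi>) (zip ts Vs) = \<phi> 0 U"
    using prep_circuit[OF pr, of 0] by auto
  define A where "A = \<lparr>anc_dim = M, init_state = \<psi>, ops = V0 # Vs, qtypes = ts, accept_proj = P\<rparr>"
  have "valid_alg N A" using h M P by (simp add: A_def valid_alg_def projector_def)
  moreover have "num_queries A = q" using h by (simp add: A_def num_queries_def)
  moreover have "accept_prob A U = p U" if "U \<in> unitaries N" for U
    using that h(7) p by (simp add: A_def accept_prob_def final_state_def)
  ultimately show ?thesis by blast
qed

lemma testable_one:
  assumes "N > 0" shows "testable N 0 (\<lambda>_. 1)"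
proof -
  let ?v = "unit_vec N 0 :: complex vec"
  have v: "vnorm2 ?v = 1"
    using assms by (simp add: vnorm2_def unit_vec_def if_distrib[of cmod] if_distrib[of "\<lambda>x. x\<^sup>2"] cong: if_cong)
  have "prep N 1 1 0 (\<lambda>_ _. ?v)" by (rule prep.init[where v = "\<lambda>_. ?v"]) (simp_all add: v)
  then show ?thesis unfolding testable_def projector_def
    by (intro exI[of _ 1] exI[of _ "\<lambda>_ _. ?v"] exI[of _ "1\<^sub>m N"]) (simp add: v)
qed

text \<open>Independent runs on separate registers, accepting when both accept. The norm of a
  product state factors, hence so does the probability.\<close>

lemma testable_mult:
  assumes "testable N q p" "testable N q' p'" and N: "N > 0"
  shows "testable N (q + q') (\<lambda>U. p U * p' U)"
proof -
  obtain M \<phi> P where 1: "M > 0" "prep N M 1 q \<phi>" "projector (N * M) P"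
    "\<forall>U\<in>unitaries N. p U = vnorm2 (P *\<^sub>v \<phi> 0 U)"
    using assms(1) unfolding testable_def by blast
  obtain M' \<phi>' P' where 2: "M' > 0" "prep N M' 1 q' \<phi>'" "projector (N * M') P'"
    "\<forall>U\<in>unitaries N. p' U = vnorm2 (P' *\<^sub>v \<phi>' 0 U)"
    using assms(2) unfolding testable_def by blast
  have c: "P \<in> carrier_mat (N * M) (N * M)" "P' \<in> carrier_mat (N * M') (N * M')"
    using 1 2 by (auto simp: projector_def)
  have "prep N (M' * (N * M)) 1 (q + q') (\<lambda>k U. tens (\<phi>' k U) (\<phi> k U))"
    using prep_tens[OF 2(2) 1(2)] .
  moreover have "projector (N * (M' * (N * M))) (kron P' P)"
    using 1(3) 2(3) kron_carrier[OF c(2) c(1)] kron_mult[OF c(2) c(2) c(1) c(1)]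
    by (simp add: projector_def adj_kron mult.assoc)
  moreover have "p U * p' U = vnorm2 (kron P' P *\<^sub>v tens (\<phi>' 0 U) (\<phi> 0 U))" if U: "U \<in> unitaries N" for U
    using kron_mult_tens[OF c(2) c(1) prep_carrier[OF 2(2) _ U] prep_carrier[OF 1(2) _ U], of 0 0] 1(4) 2(4) U
    by (simp add: vnorm2_tens)
  moreover have "M' * (N * M) > 0"
    using 1(1) 2(1) N by simp
  ultimately show ?thesis unfolding testable_def by blast
qed


lemma testable_power:
  assumes "testable N q p" "N > 0"
  shows "testable N (t * q) (\<lambda>U. p U ^ t)"
proof (induction t)
  case 0
  then show ?case using testable_one[OF assms(2)] by simp
next
  case (Suc t)
  then show ?case using testable_mult[OF assms(1) Suc assms(2)] by simp
qed

text \<open>The measurement is block diagonal in the control register, so different values of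
  \<open>k\<close> do not interfere and the superposition behaves like a uniformly random
  \<open>k\<close>.\<close>

lemma testable_average:
  assumes pr: "prep N M K q \<phi>" and M: "M > 0" and K: "K > 0"
    and P: "\<And>k. k < K \<Longrightarrow> projector (N * M) (P k)"
  shows "testable N q (\<lambda>U. (\<Sum>k<K. vnorm2 (P k *\<^sub>v \<phi> k U)) / K)"
proof -
  have c: "P k \<in> carrier_mat (N * M) (N * M)" if "k < K" for k using P[OF that] by (simp add: projector_def)
  have "projector (N * M * K) (ctrl K (N * M) P)"
    using P c by (auto simp: projector_def adj_ctrl ctrl_mult intro!: ctrl_cong)
  then have "projector (N * (M * K)) (ctrl K (N * M) P)" by (simp only: mult.assoc)
  moreover have "(\<Sum>k<K. vnorm2 (P k *\<^sub>v \<phi> k U)) / K = vnorm2 (ctrl K (N * M) P *\<^sub>v stack K (N * M) (\<lambda>k. \<phi> k U))"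
    if U: "U \<in> unitaries N" for U
  proof -
    have "ctrl K (N * M) P *\<^sub>v stack K (N * M) (\<lambda>k. \<phi> k U) = stack K (N * M) (\<lambda>k. P k *\<^sub>v \<phi> k U)"
      using c prep_carrier[OF pr _ U] by (rule ctrl_mult_stack)
    moreover have "P k *\<^sub>v \<phi> k U \<in> carrier_vec (N * M)" if "k < K" for k
      using c[OF that] prep_carrier[OF pr that U] by simp
    ultimately show ?thesis by (simp add: vnorm2_stack)
  qed
  ultimately show ?thesis unfolding testable_def
    using prep_stack[OF pr K] M K by (intro exI[of _ "M * K"] exI conjI) auto
qed

section \<open>Measurements defined by orthonormal families\<close>

definition span_proj :: "nat \<Rightarrow> 'a set \<Rightarrow> ('a \<Rightarrow> complex vec) \<Rightarrow> complex mat" where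
  "span_proj D I b = mat D D (\<lambda>(i,j). \<Sum>x\<in>I. b x $ i * cnj (b x $ j))"

lemma span_proj_mult_vec:
  assumes "u \<in> carrier_vec D" "i < D" "\<And>x. x \<in> I \<Longrightarrow> b x \<in> carrier_vec D"
  shows "(span_proj D I b *\<^sub>v u) $ i = (\<Sum>x\<in>I. b x $ i * vinner (b x) u)"
proof -
  have "(span_proj D I b *\<^sub>v u) $ i = (\<Sum>j<D. \<Sum>x\<in>I. b x $ i * (cnj (b x $ j) * u $ j))"
    using assms by (simp add: span_proj_def scalar_prod_def atLeast0LessThan sum_distrib_right mult.assoc)
  also have "\<dots> = (\<Sum>x\<in>I. \<Sum>j<D. b x $ i * (cnj (b x $ j) * u $ j))" by (rule sum.swap)
  also have "\<dots> = (\<Sum>x\<in>I. b x $ i * vinner (b x) u)"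
    using assms(3)[THEN carrier_vecD] by (intro sum.cong refl) (simp add: vinner_def sum_distrib_left)
  finally show ?thesis .
qed

lemma projector_span_proj:
  assumes I: "finite I" and b: "\<And>x. x \<in> I \<Longrightarrow> b x \<in> carrier_vec D"
    and on: "\<And>x y. x \<in> I \<Longrightarrow> y \<in> I \<Longrightarrow> vinner (b x) (b y) = (if x = y then 1 else 0)"
  shows "projector D (span_proj D I b)"
proof -
  let ?P = "span_proj D I b"
  have "adj ?P = ?P" by (rule eq_matI) (auto simp: span_proj_def mult.commute)
  moreover have "?P * ?P = ?P"
  proof (rule eq_matI)
    fix i j assume "i < dim_row ?P" "j < dim_col ?P"
    then have ij: "i < D" "j < D" by (auto simp: span_proj_def)
    have "(?P * ?P) $$ (i,j) = (\<Sum>k<D. (\<Sum>x\<in>I. b x $ i * cnj (b x $ k)) * (\<Sum>y\<in>I. b y $ k * cnj (b y $ j)))"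
      using ij by (simp add: span_proj_def scalar_prod_def atLeast0LessThan)
    also have "\<dots> = (\<Sum>k<D. \<Sum>x\<in>I. \<Sum>y\<in>I. b x $ i * cnj (b y $ j) * (cnj (b x $ k) * b y $ k))"
      unfolding sum_product by (intro sum.cong refl) (simp only: mult_ac)
    also have "\<dots> = (\<Sum>x\<in>I. \<Sum>y\<in>I. \<Sum>k<D. b x $ i * cnj (b y $ j) * (cnj (b x $ k) * b y $ k))"
      by (subst sum.swap, intro sum.cong refl, rule sum.swap)
    also have "\<dots> = (\<Sum>x\<in>I. \<Sum>y\<in>I. b x $ i * cnj (b y $ j) * vinner (b x) (b y))"
      using b[THEN carrier_vecD] by (intro sum.cong refl) (simp add: vinner_def sum_distrib_left)
    also have "\<dots> = (\<Sum>x\<in>I. \<Sum>y\<in>I. if y = x then b x $ i * cnj (b y $ j) else 0)"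
      by (intro sum.cong refl) (auto simp: on)
    also have "\<dots> = ?P $$ (i,j)" using I ij by (simp add: span_proj_def)
    finally show "(?P * ?P) $$ (i,j) = ?P $$ (i,j)" .
  qed (auto simp: span_proj_def)
  ultimately show ?thesis by (simp add: projector_def span_proj_def)
qed

lemma vnorm2_span_proj:
  assumes I: "finite I" and b: "\<And>x. x \<in> I \<Longrightarrow> b x \<in> carrier_vec D"
    and on: "\<And>x y. x \<in> I \<Longrightarrow> y \<in> I \<Longrightarrow> vinner (b x) (b y) = (if x = y then 1 else 0)"
    and u: "u \<in> carrier_vec D"
  shows "vnorm2 (span_proj D I b *\<^sub>v u) = (\<Sum>x\<in>I. (cmod (vinner (b x) u))\<^sup>2)"
proof -
  let ?c = "\<lambda>x. vinner (b x) u"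
  have "complex_of_real (vnorm2 (span_proj D I b *\<^sub>v u))
      = (\<Sum>i<D. cnj (\<Sum>x\<in>I. b x $ i * ?c x) * (\<Sum>y\<in>I. b y $ i * ?c y))"
    unfolding vinner_self[symmetric] vinner_def[of "span_proj D I b *\<^sub>v u"]
  proof (intro sum.cong)
    show "{..<dim_vec (span_proj D I b *\<^sub>v u)} = {..<D}" by (simp add: span_proj_def)
    fix i assume "i \<in> {..<D}"
    then have "(span_proj D I b *\<^sub>v u) $ i = (\<Sum>x\<in>I. b x $ i * ?c x)"
      by (intro span_proj_mult_vec[OF u _ b]) auto
    then show "cnj ((span_proj D I b *\<^sub>v u) $ i) * (span_proj D I b *\<^sub>v u) $ i
        = cnj (\<Sum>x\<in>I. b x $ i * ?c x) * (\<Sum>y\<in>I. b y $ i * ?c y)" by (simp only:)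
  qed
  also have "\<dots> = (\<Sum>i<D. \<Sum>x\<in>I. \<Sum>y\<in>I. cnj (?c x) * ?c y * (cnj (b x $ i) * b y $ i))"
    unfolding cnj_sum sum_product complex_cnj_mult by (intro sum.cong refl) (simp only: mult_ac)
  also have "\<dots> = (\<Sum>x\<in>I. \<Sum>y\<in>I. \<Sum>i<D. cnj (?c x) * ?c y * (cnj (b x $ i) * b y $ i))"
    by (subst sum.swap, intro sum.cong refl, rule sum.swap)
  also have "\<dots> = (\<Sum>x\<in>I. \<Sum>y\<in>I. cnj (?c x) * ?c y * vinner (b x) (b y))"
    using b[THEN carrier_vecD] by (intro sum.cong refl) (simp add: vinner_def[of "b _" "b _"] sum_distrib_left)
  also have "\<dots> = (\<Sum>x\<in>I. \<Sum>y\<in>I. if y = x then cnj (?c x) * ?c y else 0)"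
    by (intro sum.cong refl) (auto simp: on)
  also have "\<dots> = (\<Sum>x\<in>I. of_real ((cmod (?c x))\<^sup>2))"
    using I by (simp only: sum.delta complex_norm_square mult.commute) simp
  finally show ?thesis by (simp only: of_real_sum[symmetric] of_real_eq_iff)
qed

section \<open>The Clifford test\<close>

text \<open>The Choi state: \<open>A\<close> applied to one half of a maximally entangled pair. The
  row index is the queried system and the column index the ancilla.\<close>

definition choi :: "nat \<Rightarrow> complex mat \<Rightarrow> complex vec" where
  "choi N A = vec (N * N) (\<lambda>i. A $$ (i div N, i mod N) / of_real (sqrt N))"

lemma choi_carrier [simp]: "choi N A \<in> carrier_vec (N * N)"
  by (simp add: choi_def)

lemma kron_mult_choi:
  assumes "U \<in> carrier_mat N N" "A \<in> carrier_mat N N"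
  shows "kron U (1\<^sub>m N) *\<^sub>v choi N A = choi N (U * A)"
proof (rule eq_vecI)
  fix i assume "i < dim_vec (choi N (U * A))"
  then have i: "i < N * N" by (simp add: choi_def)
  note dm = div_mod_less[OF i]
  let ?f = "\<lambda>k l. if l = i mod N then U $$ (i div N, k) * A $$ (k, l) / of_real (sqrt N) else 0"
  have "(kron U (1\<^sub>m N) *\<^sub>v choi N A) $ i = (\<Sum>k<N*N. ?f (k div N) (k mod N))"
    using assms i by (auto simp: scalar_prod_def atLeast0LessThan index_kron[OF assms(1) one_carrier_mat] choi_def
        dest: div_mod_less intro!: sum.cong)
  also have "\<dots> = (\<Sum>k<N. \<Sum>l<N. ?f k l)" by (rule sum_div_mod)
  also have "\<dots> = choi N (U * A) $ i"
    using assms i dm by (simp add: choi_def scalar_prod_def atLeast0LessThan sum_divide_distrib)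
  finally show "(kron U (1\<^sub>m N) *\<^sub>v choi N A) $ i = choi N (U * A) $ i" .
qed (use assms in \<open>auto simp: choi_def\<close>)

lemma vinner_choi:
  assumes "A \<in> carrier_mat N N"
  shows "vinner (choi N A) (choi N B) = hs_inner A B / N"
proof -
  have "of_real (sqrt N) * of_real (sqrt N) = (of_nat N :: complex)"
    by (simp flip: of_real_mult)
  then have "vinner (choi N A) (choi N B) = (\<Sum>i<N*N. (\<lambda>k l. cnj (A $$ (k,l)) * B $$ (k,l) / N) (i div N) (i mod N))"
    by (simp add: vinner_def choi_def)
  also have "\<dots> = (\<Sum>k<N. \<Sum>l<N. cnj (A $$ (k,l)) * B $$ (k,l) / N)" by (rule sum_div_mod)
  finally show ?thesis using assms by (simp add: hs_inner_def sum_divide_distrib)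
qed

text \<open>From the maximally entangled state the represented operator evolves as \<open>1\<close>,
  \<open>adj U\<close>, \<open>g k * adj U\<close>, \<open>U * g k * adj U\<close>, since operations
  on the system multiply on the left.\<close>

lemma prep_conjugate:
  assumes N: "N > 0" and g: "\<And>k. k < K \<Longrightarrow> unitary_mat N (g k)"
  shows "prep N N K 2 (\<lambda>k U. choi N (U * g k * adj U))"
proof -
  have "hs_inner (1\<^sub>m N) (1\<^sub>m N) = of_nat N"
    by (simp add: hs_inner_self hs_norm_unitary_square[OF unitary_mat_one] flip: of_real_power)
  then have "complex_of_real (vnorm2 (choi N (1\<^sub>m N))) = 1"
    using N by (simp add: vinner_self[symmetric] vinner_choi)
  then have n1: "vnorm2 (choi N (1\<^sub>m N)) = 1" by (simp only: of_real_eq_1_iff)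
  have c: "U \<in> carrier_mat N N" if "U \<in> unitaries N" for U
    using that by (simp add: unitaries_def unitary_mat_def)
  have "prep N N K 0 (\<lambda>k U. choi N (1\<^sub>m N))"
    by (rule prep.init[where v = "\<lambda>_. choi N (1\<^sub>m N)"]) (simp_all add: n1)
  then have "prep N N K (Suc 0) (\<lambda>k U. choi N (adj U))"
    by (rule prep.query[where b = True]) (simp add: query_op_def kron_mult_choi c right_mult_one_mat[OF adj_carrier[OF c]])
  then have "prep N N K (Suc 0) (\<lambda>k U. choi N (g k * adj U))"
    by (rule prep.op[where V = "\<lambda>k. kron (g k) (1\<^sub>m N)"])
      (simp_all add: kron_mult_choi c unitary_matD(1)[OF g] kron_one_unitary[OF g])
  then have "prep N N K (Suc (Suc 0)) (\<lambda>k U. choi N (U * g k * adj U))"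
  proof (rule prep.query[where b = False])
    fix k U assume "k < K" and U: "U \<in> unitaries N"
    then have gc: "g k \<in> carrier_mat N N" using unitary_matD(1)[OF g] by simp
    show "choi N (U * g k * adj U) = query_op U N False *\<^sub>v choi N (g k * adj U)"
      using kron_mult_choi[of U N "g k * adj U"] gc c[OF U]
      by (simp add: query_op_def assoc_mult_mat[of _ N N _ N _ N])
  qed
  then show ?thesis by (simp add: numeral_2_eq_2)
qed

text \<open>The accepting subspace is spanned by the doubled vectors \<open>b xs\<close>, so
  projecting onto it is the event that both copies give the same Pauli string. Each copy costs two
  queries.\<close>

lemma testable_collision:
  "testable (2 ^ n) 4 (\<lambda>U. (\<Sum>g\<in>pauli_group n. collision n U g) / card (pauli_group n))"
proof -
  let ?N = "2 ^ n :: nat" and ?G = "pauli_group n" and ?K = "card (pauli_group n)"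
  obtain e where e: "bij_betw e {0..<?K} ?G" using ex_bij_betw_nat_finite[OF finite_pauli_group] by blast
  have eG: "e k \<in> ?G" if "k < ?K" for k using bij_betwE[OF e] that by auto
  let ?\<phi> = "\<lambda>k U. choi ?N (U * e k * adj U)"
  have "prep ?N ?N ?K 2 ?\<phi>" by (rule prep_conjugate) (simp_all add: pauli_group_unitary[OF eG])
  then have pr: "prep ?N (?N * (?N * ?N)) ?K (2 + 2) (\<lambda>k U. tens (?\<phi> k U) (?\<phi> k U))"
    using prep_tens by blast
  define b where "b xs = tens (choi ?N (pauli_string xs)) (choi ?N (pauli_string xs))" for xs
  let ?D = "?N * (?N * (?N * ?N))"
  have D: "?D = ?N * ?N * (?N * ?N)" by (simp only: mult.assoc)
  have bc: "b xs \<in> carrier_vec ?D" for xs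
    unfolding b_def D by (intro tens_carrier choi_carrier)
  have inner: "vinner (b xs) (tens (choi ?N A) (choi ?N A)) = (hs_inner (pauli_string xs) A / 2 ^ n)\<^sup>2"
    if "xs \<in> pauli_strings n" for xs A
    unfolding b_def using that
    by (subst vinner_tens[OF choi_carrier choi_carrier choi_carrier choi_carrier])
       (simp add: vinner_choi power2_eq_square)
  have on: "vinner (b xs) (b ys) = (if xs = ys then 1 else 0)"
    if "xs \<in> pauli_strings n" "ys \<in> pauli_strings n" for xs ys
    using inner[OF that(1), of "pauli_string ys"] pauli_string_orthogonal[OF that]
    by (simp add: b_def[of ys])
  let ?P = "span_proj ?D (pauli_strings n) b"
  have P: "projector ?D ?P" using bc on by (intro projector_span_proj) auto
  have "testable ?N (2 + 2) (\<lambda>U. (\<Sum>k<?K. vnorm2 (?P *\<^sub>v tens (?\<phi> k U) (?\<phi> k U))) / ?K)"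
    by (rule testable_average[OF pr]) (simp_all add: P card_pauli_group_pos)
  moreover have "(\<Sum>k<?K. vnorm2 (?P *\<^sub>v tens (?\<phi> k U) (?\<phi> k U))) = (\<Sum>g\<in>?G. collision n U g)" for U
  proof -
    have "vnorm2 (?P *\<^sub>v tens (?\<phi> k U) (?\<phi> k U)) = collision n U (e k)" for k
    proof -
      have "tens (?\<phi> k U) (?\<phi> k U) \<in> carrier_vec ?D"
        unfolding D by (intro tens_carrier choi_carrier)
      then have "vnorm2 (?P *\<^sub>v tens (?\<phi> k U) (?\<phi> k U))
          = (\<Sum>xs\<in>pauli_strings n. (cmod (vinner (b xs) (tens (?\<phi> k U) (?\<phi> k U))))\<^sup>2)"
        using bc on by (intro vnorm2_span_proj) auto
      also have "\<dots> = collision n U (e k)"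
        unfolding collision_def
        by (intro sum.cong refl) (simp add: inner norm_power norm_divide flip: power_mult)
      finally show ?thesis .
    qed
    then show ?thesis
      using sum.reindex_bij_betw[OF e, of "collision n U"] by (simp add: atLeast0LessThan)
  qed
  ultimately show ?thesis by simp
qed

text \<open>The global phase cancels under conjugation, and the conjugate is a single Pauli
  operator, whose coefficient alone already contributes 1.\<close>

lemma collision_has_property:
  assumes "has_property (clifford_group n) U" and g: "g \<in> pauli_group n"
  shows "collision n U g \<ge> 1"
proof -
  let ?N = "2 ^ n :: nat"
  obtain V \<theta> where V: "V \<in> clifford_group n" and U: "U = exp (\<i> * of_real \<theta>) \<cdot>\<^sub>m V"
    using assms(1) by (auto simp: has_property_def)
  let ?w = "exp (\<i> * of_real \<theta>)"
  have w: "?w * cnj ?w = 1"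
    by (simp add: complex_norm_square[symmetric])
  have Vc: "V \<in> carrier_mat ?N ?N" using V by (simp add: clifford_group_def unitaries_def unitary_mat_def)
  have VgV: "V * g * adj V \<in> carrier_mat ?N ?N" using Vc g by simp
  have "U * g * adj U = (cnj ?w * ?w) \<cdot>\<^sub>m (V * g * adj V)"
    unfolding U using Vc g
    by (simp only: adj_smult mult_smult_assoc_mat[of _ ?N ?N _ ?N] mult_smult_distrib[of _ ?N ?N _ ?N]
        smult_smult_mat pauli_group_carrier adj_carrier mult_square_carrier smult_carrier_mat)
  then have eq: "U * g * adj U = V * g * adj V" using w by (simp only: mult.commute[of "cnj _"] smult_one_mat)
  have "V * g * adj V \<in> pauli_group n" using V g by (simp add: clifford_group_def)
  then obtain k xs where x: "xs \<in> pauli_strings n" "V * g * adj V = \<i> ^ k \<cdot>\<^sub>m pauli_string xs"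
    by (rule pauli_groupE)
  have "cmod (hs_inner (pauli_string xs) (U * g * adj U)) = 2 ^ n"
    using x(1) unfolding eq x(2)
    by (simp add: hs_inner_smult_right[of _ ?N ?N] pauli_string_orthogonal norm_mult norm_power)
  then have "1 = (cmod (hs_inner (pauli_string xs) (U * g * adj U)) / 2 ^ n) ^ 4" by simp
  also have "\<dots> \<le> collision n U g"
    unfolding collision_def using x(1) by (intro member_le_sum) auto
  finally show ?thesis .
qed

text \<open>With \<delta> the mean deficit, either \<delta> is at least 1/80, which suffices as
  \<epsilon> is at most 1, or rounding applies and gives \<delta> at least a quarter of the square
  of \<epsilon>. The constant 80 covers both cases.\<close>

lemma collision_eps_far:
  assumes U: "U \<in> unitaries (2 ^ n)" and far: "eps_far \<epsilon> (clifford_group n) U"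
    and eps: "0 < \<epsilon>" "\<epsilon> \<le> 1"
  shows "(\<Sum>g\<in>pauli_group n. collision n U g) / card (pauli_group n) \<le> 1 - \<epsilon>\<^sup>2 / 80"
proof -
  let ?m = "real (card (pauli_group n))"
  define \<delta> where "\<delta> = (\<Sum>g\<in>pauli_group n. 1 - collision n U g) / ?m"
  have m: "?m > 0" using card_pauli_group_pos by simp
  have eps2: "\<epsilon>\<^sup>2 \<le> 1" using eps by (simp add: power_le_one)
  have "\<epsilon>\<^sup>2 / 80 \<le> \<delta>"
  proof (cases "\<delta> < 1 / 80")
    case True
    then have "(\<Sum>g\<in>pauli_group n. 1 - collision n U g) < ?m / 80"
      using m by (simp add: \<delta>_def field_simps)
    then obtain W where "W \<in> clifford_group n" "dist_phase U W \<le> sqrt (4 * \<delta>)"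
      using clifford_rounding[of n U] U by (auto simp: unitaries_def \<delta>_def)
    then have "\<epsilon> \<le> sqrt (4 * \<delta>)" using far by (meson eps_far_def order_trans)
    then have "\<epsilon>\<^sup>2 \<le> 4 * \<delta>" using eps by (intro sqrt_ge_absD) simp
    then show ?thesis using zero_le_power2[of \<epsilon>] by linarith
  qed (use eps2 in simp)
  moreover have "\<delta> = 1 - (\<Sum>g\<in>pauli_group n. collision n U g) / ?m"
    using pauli_group_one[of n] by (auto simp: \<delta>_def sum_subtractf diff_divide_distrib)
  ultimately show ?thesis by simp
qed

lemma dist_phase_le_1:
  assumes "unitary_mat N U" "unitary_mat N V" "N > 0"
  shows "dist_phase U V \<le> 1"
proof -
  have "dist_phase U V \<le> sqrt (1 - cmod (hs_inner U V) / N)" by (rule dist_phase_le[OF assms])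
  also have "\<dots> \<le> sqrt 1" by (rule real_sqrt_le_mono) simp
  finally show ?thesis by simp
qed

lemma one_in_clifford_group: "1\<^sub>m (2 ^ n) \<in> clifford_group n"
  by (auto simp: clifford_group_def unitaries_def left_mult_one_mat[OF pauli_group_carrier]
      right_mult_one_mat[OF pauli_group_carrier])

theorem theorem3:
  shows "\<exists>C::real. C > 0 \<and>
    (\<forall>n::nat. \<forall>\<epsilon>::real. n \<ge> 1 \<longrightarrow> \<epsilon> > 0 \<longrightarrow>
       (\<exists>A. eps_tests (2 ^ n) \<epsilon> (clifford_group n) A \<and>
            real (num_queries A) \<le> C / \<epsilon>\<^sup>2))"
proof (intro exI[of _ 644] conjI allI impI)
  fix n :: nat and \<epsilon> :: real
  assume eps: "\<epsilon> > 0"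
  let ?N = "2 ^ n :: nat"
  define p where "p U = (\<Sum>g\<in>pauli_group n. collision n U g) / card (pauli_group n)" for U
  \<comment> \<open>One round passes a far input with probability at most
    \<open>exp (- (\<epsilon>\<^sup>2 / 80))\<close>, so 160 = 2 * 80 yields
    \<open>exp (- 2)\<close>, which is below 1/3. For \<epsilon> > 1 zero rounds are used: the
    permitted count can drop below one query, and no unitary is that far from the identity.\<close>
  define t where "t = (if \<epsilon> \<le> 1 then nat \<lceil>160 / \<epsilon>\<^sup>2\<rceil> else 0)"
  have "testable ?N (t * 4) (\<lambda>U. p U ^ t)"
    unfolding p_def by (rule testable_power[OF testable_collision]) simp
  then obtain A where A: "valid_alg ?N A" "num_queries A = t * 4"
    "\<And>U. U \<in> unitaries ?N \<Longrightarrow> accept_prob A U = p U ^ t"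
    using testable_alg by blast
  have complete: "p U ^ t \<ge> 2/3" if "has_property (clifford_group n) U" for U
  proof -
    have "(\<Sum>g\<in>pauli_group n. 1) \<le> (\<Sum>g\<in>pauli_group n. collision n U g)"
      using collision_has_property[OF that] by (intro sum_mono)
    then have "p U \<ge> 1" using card_pauli_group_pos[of n] by (simp add: p_def)
    then have "p U ^ t \<ge> 1" by (rule one_le_power)
    then show ?thesis by simp
  qed
  have sound: "p U ^ t \<le> 1/3" if U: "U \<in> unitaries ?N" and far: "eps_far \<epsilon> (clifford_group n) U" for U
  proof -
    have "\<epsilon> \<le> dist_phase U (1\<^sub>m ?N)" using far one_in_clifford_group by (simp add: eps_far_def)
    also have "\<dots> \<le> 1" using U by (intro dist_phase_le_1[of ?N]) (auto simp: unitaries_def)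
    finally have e1: "\<epsilon> \<le> 1" .
    have "real t \<ge> 160 / \<epsilon>\<^sup>2" using e1 unfolding t_def by simp
    then have t: "\<epsilon>\<^sup>2 / 80 * real t \<ge> 2" using eps by (simp add: field_simps)
    have "p U \<ge> 0" unfolding p_def collision_def by (intro divide_nonneg_nonneg sum_nonneg) auto
    moreover have "p U \<le> exp (- (\<epsilon>\<^sup>2 / 80))"
      using collision_eps_far[OF U far eps e1] exp_ge_add_one_self[of "- (\<epsilon>\<^sup>2 / 80)"] by (simp add: p_def)
    ultimately have "p U ^ t \<le> exp (- (\<epsilon>\<^sup>2 / 80)) ^ t" by (intro power_mono)
    also have "\<dots> = exp (- (\<epsilon>\<^sup>2 / 80 * real t))" by (simp add: exp_of_nat_mult[symmetric] mult.commute)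
    also have "\<dots> \<le> exp (- 2)" using t by simp
    also have "\<dots> \<le> 1/3" using exp_ge_add_one_self[of 2] by (simp add: exp_minus field_simps)
    finally show ?thesis .
  qed
  \<comment> \<open>Four queries per round give 644 = 4 * (160 + 1). The extra 1 pays for the
    ceiling, which is at most \<open>1 / \<epsilon>\<^sup>2\<close> when \<epsilon> is at most
    1.\<close>
  have "real (num_queries A) \<le> 644 / \<epsilon>\<^sup>2"
  proof (cases "\<epsilon> \<le> 1")
    case True
    have "real t \<le> 160 / \<epsilon>\<^sup>2 + 1" using True unfolding t_def by simp
    moreover have "1 \<le> 1 / \<epsilon>\<^sup>2" using True eps by (simp add: power_le_one)
    ultimately have "4 * real t \<le> 4 * (160 / \<epsilon>\<^sup>2 + 1 / \<epsilon>\<^sup>2)" by simp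
    then show ?thesis by (simp add: A(2) field_simps)
  qed (simp add: A(2) t_def)
  then show "\<exists>A. eps_tests ?N \<epsilon> (clifford_group n) A \<and> real (num_queries A) \<le> 644 / \<epsilon>\<^sup>2"
    using A complete sound unfolding eps_tests_def by (intro exI[of _ A]) simp
qed simp

end
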